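(* Consider the TV-ARMA($p,q$) equation with deterministic coefficients $y_t=\varphi(t)+\sum_{m=1}^{p}\phi_m(t)y_{t-m}+\varepsilon_t+\sum_{l=1}^{q}\theta_l(t)\varepsilon_{t-l}$, $t\in\mathbb{Z}$. Suppose $\varphi(t)$, $\phi_m(t)$ ($1\le m\le p$), $\theta_l(t)$ ($1\le l\le q$) are bounded in $t$, and that $\sum_{r=-\infty}^{t}|\xi(t,r)|<\infty$ and $\sum_{r=-\infty}^{t}|\vartheta(t,r)|<\infty$ for all $t$. Let $y_t=\sum_{r=-\infty}^{t}\xi(t,r)\varphi(r)+\sum_{r=-\infty}^{t}\xi_q(t,r)\varepsilon_r$ be the unique asymptotically stable solution, let $s<t$ and $k=t-s$. Then the $k$-step-ahead optimal (in the $L_2$ sense) predictor of $y_t$ is linear and is given by $$\mathbb{E}(y_t\mid\mathcal{M}_s)=\sum_{r=-\infty}^{t}\xi(t,r)\varphi(r)+\sum_{r=-\infty}^{s}\xi_q(t,r)\varepsilon_r,$$ where, for $r\le s$, $\varepsilon_r=\sum_{j=-\infty}^{r}\vartheta_p(r,j)y_j-\sum_{j=-\infty}^{r}\vartheta(r,j)\varphi(j)$. The forecast error $\mathbb{FE}_{t,s}:=y_t-\mathbb{E}(y_t\mid\mathcal{M}_s)$ and the associated mean square error $\mathbb{MSE}_{t,s}:=\operatorname{Var}(\mathbb{FE}_{t,s})$ are given by $$\mathbb{FE}_{t,s}=\sum_{r=s+1}^{t}\xi_q(t,r)\varepsilon_r,\qquad \mathbb{MSE}_{t,s}=\sum_{r=s+1}^{t}\xi_q^2(t,r)\sigma^2(r).$$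 Moreover, the expectation of $\mathbb{FE}_{t,s}$ is zero, i.e. the forecast is unbiased.
   Context: Let $p,q\ge 1$ be integers. The coefficients $\varphi(t),\phi_m(t),\theta_l(t)$ are deterministic real-valued functions of $t\in\mathbb{Z}$. The errors satisfy $\mathbb{E}(\varepsilon_t)=0$, $\mathbb{E}(\varepsilon_t\varepsilon_s)=0$ for $s\ne t$, $\mathbb{E}(\varepsilon_t\mid y_s,s<t)=0$, $\mathbb{E}(\varepsilon_t^2)=\sigma^2(t)$ with $0<\sigma^2(t)\le M<\infty$ for all $t$ and some $M$. Infinite sums of random variables are limits in $L_2=L_2(\Omega,\mathcal F,P)$. $\mathcal{M}_s$ is the smallest closed subspace of $L_2$ containing $\{y_s,y_{s-1},\dots\}$ and all constant functions; $\mathbb{E}(y_t\mid\mathcal{M}_s)$ is the orthogonal projection of $y_t$ on $\mathcal{M}_s$. A solution $y_t$ is asymptotically stable if for each $t$, $\sum_{m=1}^{p}\xi^{(m)}(t,s)y_{s+1-m}\to 0$ in $L_2$ as $s\to-\infty$, where $\xi^{(m)}(t,s)=\sum_{r=1}^{p+1-m}\phi_{m-1+r}(s+r)\xi(t,s+r)$. For integers $s<t$, $\xi(t,s)=\det(\mathbf{\Phi}_{t,s})$, where $\mathbf{\Phi}_{t,s}$ is the $(t-s)\times(t-s)$ matrix whose $(i,j)$ entry is $\phi_{i-j+1}(s+i)$ if $0\le i-j\le p-1$, $-1$ if $j=i+1$, and $0$ otherwise; $\xi(t,t)=1$ and $\xi(t,s)=0$ for $t<s$. Also $\xi_q(t,r)=\xi(t,r)+\sum_{l=1}^{q}\xi(t,r+l)\theta_l(r+l)$.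 For integers $s<t$, $\vartheta(t,s)=\det(\mathbf{\Theta}(t,s))$, where $\mathbf{\Theta}(t,s)$ is the $(t-s)\times(t-s)$ matrix whose $(i,j)$ entry is $-\theta_{i-j+1}(s+i)$ if $0\le i-j\le q-1$, $-1$ if $j=i+1$, and $0$ otherwise; $\vartheta(t,t)=1$ and $\vartheta(t,s)=0$ for $t<s$. Also $\vartheta_p(t,r)=\vartheta(t,r)-\sum_{m=1}^{p}\vartheta(t,r+m)\phi_m(r+m)$.
   Formalization: The formula for ε_r via ϑ_p(r,j)y_j can fail (series may diverge in L2 when E y_j² is unbounded); it is proved exactly when Σ_m ϑ^{(m)}(r,u)y_{u+1-m}→0 in L2 (e.g. E y_j² bounded for j≤s), plus an unconditional version with ϑ(r,j)[y_j−Σφ_m(j)y_{j-m}]. *)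

theory Defs
  imports "HOL-Probability.Probability" "Jordan_Normal_Form.Determinant"
begin

section \<open>Square-integrable random variables\<close>

definition L2 :: "'a measure \<Rightarrow> ('a \<Rightarrow> real) set" where
  "L2 M = {X \<in> borel_measurable M. integrable M (\<lambda>\<omega>. (X \<omega>)\<^sup>2)}"

definition tendsto_L2 ::
  "'a measure \<Rightarrow> ('i \<Rightarrow> 'a \<Rightarrow> real) \<Rightarrow> ('a \<Rightarrow> real) \<Rightarrow> 'i filter \<Rightarrow> bool" where
  "tendsto_L2 M X Z F \<longleftrightarrow>
     (\<forall>\<^sub>F i in F. X i \<in> L2 M) \<and> Z \<in> L2 M \<and>
     ((\<lambda>i. \<integral>\<omega>. (X i \<omega> - Z \<omega>)\<^sup>2 \<partial>M) \<longlongrightarrow> 0) F"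

text \<open>\<open>has_L2_sum M X t Z\<close> means that the sum of \<open>X r\<close> over \<open>r \<le> t\<close>, i.e. the limit in mean square
  of the sums over \<open>{n..t}\<close> as \<open>n\<close> tends to minus infinity, exists and equals \<open>Z\<close>
  (almost everywhere).\<close>

definition has_L2_sum ::
  "'a measure \<Rightarrow> (int \<Rightarrow> 'a \<Rightarrow> real) \<Rightarrow> int \<Rightarrow> ('a \<Rightarrow> real) \<Rightarrow> bool" where
  "has_L2_sum M X t Z \<longleftrightarrow> tendsto_L2 M (\<lambda>n \<omega>. \<Sum>r\<in>{n..t}. X r \<omega>) Z at_bot"

text \<open>Elements of \<open>L2 M\<close> are functions, not classes modulo null sets; closedness under limits
  makes every closed subspace invariant under almost everywhere equality.\<close>

definition closed_L2_subspace :: "'a measure \<Rightarrow> ('a \<Rightarrow> real) set \<Rightarrow> bool" where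
  "closed_L2_subspace M S \<longleftrightarrow>
     S \<subseteq> L2 M \<and> (\<lambda>\<omega>. 0) \<in> S \<and>
     (\<forall>X\<in>S. \<forall>Y\<in>S. (\<lambda>\<omega>. X \<omega> + Y \<omega>) \<in> S) \<and>
     (\<forall>c. \<forall>X\<in>S. (\<lambda>\<omega>. c * X \<omega>) \<in> S) \<and>
     (\<forall>X Z. (\<forall>n::nat. X n \<in> S) \<and> tendsto_L2 M X Z sequentially \<longrightarrow> Z \<in> S)"

definition past_space :: "'a measure \<Rightarrow> (int \<Rightarrow> 'a \<Rightarrow> real) \<Rightarrow> int \<Rightarrow> ('a \<Rightarrow> real) set" where
  "past_space M y s =
     \<Inter>{S. closed_L2_subspace M S \<and> (\<forall>j\<le>s. y j \<in> S) \<and> (\<forall>c. (\<lambda>\<omega>. c) \<in> S)}"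

text \<open>Orthogonal projections are determined only up to null sets, hence a predicate.\<close>

definition is_L2_projection ::
  "'a measure \<Rightarrow> ('a \<Rightarrow> real) set \<Rightarrow> ('a \<Rightarrow> real) \<Rightarrow> ('a \<Rightarrow> real) \<Rightarrow> bool" where
  "is_L2_projection M S X P \<longleftrightarrow> P \<in> S \<and> (\<forall>Z\<in>S. (\<integral>\<omega>. (X \<omega> - P \<omega>) * Z \<omega> \<partial>M) = 0)"

definition past_algebra :: "'a measure \<Rightarrow> (int \<Rightarrow> 'a \<Rightarrow> real) \<Rightarrow> int \<Rightarrow> 'a measure" where
  "past_algebra M y s =
     sigma (space M) (\<Union>j\<in>{..s}. {y j -` A \<inter> space M |A. A \<in> sets borel})"

section \<open>Banded Hessenbergian determinants\<close>

text \<open>\<open>hessenbergian p c t s\<close> is the determinant of the \<open>(t - s) \<times> (t - s)\<close> matrix with \<open>-1\<close> on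
  the superdiagonal and entry \<open>c (i - j + 1) (s + i)\<close> in the \<open>p\<close> bands \<open>0 \<le> i - j \<le> p - 1\<close>.
  Matrix indices of the library start at 0, so row \<open>i\<close> here belongs to time \<open>s + i + 1\<close>.\<close>

definition hessenbergian :: "nat \<Rightarrow> (nat \<Rightarrow> int \<Rightarrow> real) \<Rightarrow> int \<Rightarrow> int \<Rightarrow> real" where
  "hessenbergian p c t s =
     (if s < t then
        Determinant.det (Matrix.mat (nat (t - s)) (nat (t - s)) (\<lambda>(i, j).
          if j \<le> i \<and> i - j < p then c (i - j + 1) (s + int i + 1)
          else if j = i + 1 then -1 else 0))
      else if s = t then 1 else 0)"

definition xi :: "nat \<Rightarrow> (nat \<Rightarrow> int \<Rightarrow> real) \<Rightarrow> int \<Rightarrow> int \<Rightarrow> real" where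
  "xi p \<phi> t s = hessenbergian p \<phi> t s"

definition xi_q ::
  "nat \<Rightarrow> nat \<Rightarrow> (nat \<Rightarrow> int \<Rightarrow> real) \<Rightarrow> (nat \<Rightarrow> int \<Rightarrow> real) \<Rightarrow> int \<Rightarrow> int \<Rightarrow> real" where
  "xi_q p q \<phi> \<theta> t r =
     xi p \<phi> t r + (\<Sum>l=1..q. xi p \<phi> t (r + int l) * \<theta> l (r + int l))"

definition vtheta :: "nat \<Rightarrow> (nat \<Rightarrow> int \<Rightarrow> real) \<Rightarrow> int \<Rightarrow> int \<Rightarrow> real" where
  "vtheta q \<theta> t s = hessenbergian q (\<lambda>l u. - \<theta> l u) t s"

definition vtheta_p ::
  "nat \<Rightarrow> nat \<Rightarrow> (nat \<Rightarrow> int \<Rightarrow> real) \<Rightarrow> (nat \<Rightarrow> int \<Rightarrow> real) \<Rightarrow> int \<Rightarrow> int \<Rightarrow> real" where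
  "vtheta_p p q \<phi> \<theta> t r =
     vtheta q \<theta> t r - (\<Sum>m=1..p. vtheta q \<theta> t (r + int m) * \<phi> m (r + int m))"

section \<open>Time-varying ARMA processes\<close>

definition tv_arma_errors ::
  "'a measure \<Rightarrow> (int \<Rightarrow> 'a \<Rightarrow> real) \<Rightarrow> (int \<Rightarrow> 'a \<Rightarrow> real) \<Rightarrow> (int \<Rightarrow> real) \<Rightarrow> bool" where
  "tv_arma_errors M y \<epsilon> \<sigma> \<longleftrightarrow>
     (\<forall>t. \<epsilon> t \<in> L2 M) \<and>
     (\<forall>t. (\<integral>\<omega>. \<epsilon> t \<omega> \<partial>M) = 0) \<and>
     (\<forall>t s. s \<noteq> t \<longrightarrow> (\<integral>\<omega>. \<epsilon> t \<omega> * \<epsilon> s \<omega> \<partial>M) = 0) \<and>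
     (\<forall>t. AE \<omega> in M. real_cond_exp M (past_algebra M y (t - 1)) (\<epsilon> t) \<omega> = 0) \<and>
     (\<forall>t. (\<integral>\<omega>. (\<epsilon> t \<omega>)\<^sup>2 \<partial>M) = (\<sigma> t)\<^sup>2) \<and>
     (\<exists>K. \<forall>t. 0 < (\<sigma> t)\<^sup>2 \<and> (\<sigma> t)\<^sup>2 \<le> K)"

text \<open>The intercept, written \<open>\<phi>0\<close> here, is the function \<open>\<phi>\<close> without index.\<close>

definition tv_arma_solution ::
  "'a measure \<Rightarrow> nat \<Rightarrow> nat \<Rightarrow> (int \<Rightarrow> real) \<Rightarrow> (nat \<Rightarrow> int \<Rightarrow> real) \<Rightarrow> (nat \<Rightarrow> int \<Rightarrow> real) \<Rightarrow>
   (int \<Rightarrow> 'a \<Rightarrow> real) \<Rightarrow> (int \<Rightarrow> 'a \<Rightarrow> real) \<Rightarrow> bool" where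
  "tv_arma_solution M p q \<phi>0 \<phi> \<theta> \<epsilon> y \<longleftrightarrow>
     (\<forall>t. y t \<in> L2 M) \<and>
     (\<forall>t. AE \<omega> in M. y t \<omega> = \<phi>0 t + (\<Sum>m=1..p. \<phi> m t * y (t - int m) \<omega>)
                           + \<epsilon> t \<omega> + (\<Sum>l=1..q. \<theta> l t * \<epsilon> (t - int l) \<omega>))"

text \<open>The boundary term is the sum over \<open>m\<close> of \<open>g\<^sup>(\<^sup>m\<^sup>)(t,s) y(s+1-m)\<close>, where
  \<open>g\<^sup>(\<^sup>m\<^sup>)(t,s)\<close> is formed from a kernel \<open>g\<close> as \<open>\<xi>\<^sup>(\<^sup>m\<^sup>)(t,s)\<close> is from \<open>\<xi>\<close>. For \<open>g = \<xi>\<close> it occurs in the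
  definition of asymptotic stability. For \<open>g = vtheta q \<theta>\<close> it is the exact difference between the
  sums over \<open>j \<in> {s+1..t}\<close> of \<open>vtheta_p p q \<phi> \<theta> t j * y j\<close> and of
  \<open>vtheta q \<theta> t j * (y j - (\<Sum>m=1..p. \<phi> m j * y (j - int m)))\<close>. Absolute summability of the two
  kernels at each \<open>t\<close> does not make it vanish as \<open>s \<rightarrow> -\<infinity>\<close>: the mean squares of \<open>y\<close> may be
  unbounded, and the series with \<open>vtheta_p\<close> may then diverge.\<close>

definition boundary_term ::
  "nat \<Rightarrow> (nat \<Rightarrow> int \<Rightarrow> real) \<Rightarrow> (int \<Rightarrow> int \<Rightarrow> real) \<Rightarrow> (int \<Rightarrow> 'a \<Rightarrow> real) \<Rightarrow>
   int \<Rightarrow> int \<Rightarrow> 'a \<Rightarrow> real" where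
  "boundary_term p \<phi> g y t s \<omega> =
     (\<Sum>m=1..p. (\<Sum>r=1..p + 1 - m. \<phi> (m - 1 + r) (s + int r) * g t (s + int r))
                * y (s + 1 - int m) \<omega>)"

definition asymptotically_stable ::
  "'a measure \<Rightarrow> nat \<Rightarrow> (nat \<Rightarrow> int \<Rightarrow> real) \<Rightarrow> (int \<Rightarrow> 'a \<Rightarrow> real) \<Rightarrow> bool" where
  "asymptotically_stable M p \<phi> y \<longleftrightarrow>
     (\<forall>t. tendsto_L2 M (\<lambda>s. boundary_term p \<phi> (xi p \<phi>) y t s) (\<lambda>\<omega>. 0) at_bot)"

end

theory Submission
  imports Defs
begin

text \<open>
  Laplace expansion along the first column gives the recurrence of a banded Hessenbergian in its
  second argument. Summing \<open>\<vartheta>(r,j)\<close> against the moving average \<open>\<epsilon>\<^sub>j + \<Sum>\<^sub>l \<theta>\<^sub>l(j) \<epsilon>\<^sub>j\<^sub>-\<^sub>l\<close> over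
  \<open>n \<le> j \<le> r\<close> therefore collapses to \<open>\<epsilon>\<^sub>r\<close> plus a boundary term at \<open>n\<close>, which vanishes in mean square
  because \<open>\<vartheta>(r,n) \<rightarrow> 0\<close>. Hence \<open>\<epsilon>\<^sub>r\<close> lies in the closed span of constants and the \<open>y\<^sub>j\<close> with
  \<open>j \<le> r\<close>, while \<open>\<epsilon>\<^sub>r\<close> with \<open>r > s\<close> is orthogonal to everything generated by the \<open>y\<^sub>j\<close> with \<open>j \<le> s\<close>.
  Cutting the representation of \<open>y\<^sub>t\<close> at \<open>s\<close> thus splits it into its projection and the forecast
  error. The same summation with the autoregressive coefficients relates the two inversion series.
\<close>

section \<open>Convergence in mean square\<close>

lemma L2D: "X \<in> L2 M \<Longrightarrow> X \<in> borel_measurable M" "X \<in> L2 M \<Longrightarrow> integrable M (\<lambda>\<omega>. (X \<omega>)\<^sup>2)"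
  by (auto simp: L2_def)

lemma L2_integrable_mult:
  assumes "X \<in> L2 M" "Y \<in> L2 M"
  shows "integrable M (\<lambda>\<omega>. X \<omega> * Y \<omega>)"
proof (rule Bochner_Integration.integrable_bound)
  show "integrable M (\<lambda>\<omega>. (X \<omega>)\<^sup>2 + (Y \<omega>)\<^sup>2)"
    using assms by (auto simp: L2_def)
  show "(\<lambda>\<omega>. X \<omega> * Y \<omega>) \<in> borel_measurable M"
    using assms by (auto simp: L2_def)
  have "\<bar>a * b\<bar> \<le> a\<^sup>2 + b\<^sup>2" for a b :: real
  proof -
    have "2 * (\<bar>a\<bar> * \<bar>b\<bar>) \<le> a\<^sup>2 + b\<^sup>2"
      using sum_squares_bound[of "\<bar>a\<bar>" "\<bar>b\<bar>"] by (simp add: mult.assoc)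
    moreover have "0 \<le> \<bar>a\<bar> * \<bar>b\<bar>" by simp
    ultimately show ?thesis unfolding abs_mult by linarith
  qed
  then show "AE \<omega> in M. norm (X \<omega> * Y \<omega>) \<le> norm ((X \<omega>)\<^sup>2 + (Y \<omega>)\<^sup>2)"
    by (auto intro!: AE_I2)
qed

lemma L2_cmult: "X \<in> L2 M \<Longrightarrow> (\<lambda>\<omega>. c * X \<omega>) \<in> L2 M"
  by (auto simp: L2_def power_mult_distrib)

lemma L2_add:
  assumes "X \<in> L2 M" "Y \<in> L2 M"
  shows "(\<lambda>\<omega>. X \<omega> + Y \<omega>) \<in> L2 M"
  using L2_integrable_mult[OF assms] assms
  by (auto simp: L2_def power2_sum mult.assoc)

lemma L2_diff:
  assumes "X \<in> L2 M" "Y \<in> L2 M"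
  shows "(\<lambda>\<omega>. X \<omega> - Y \<omega>) \<in> L2 M"
  using L2_add[OF assms(1) L2_cmult[OF assms(2), of "-1"]] by simp

lemma L2_zero: "(\<lambda>\<omega>. 0) \<in> L2 M"
  by (auto simp: L2_def)

lemma L2_sum: "(\<And>i. i \<in> A \<Longrightarrow> X i \<in> L2 M) \<Longrightarrow> (\<lambda>\<omega>. \<Sum>i\<in>A. X i \<omega>) \<in> L2 M"
  by (induction A rule: infinite_finite_induct) (auto intro: L2_zero L2_add)

lemma (in finite_measure) L2_const: "(\<lambda>\<omega>. c) \<in> L2 M"
  by (auto simp: L2_def)

text \<open>The mean square of \<open>u * X + v * Y\<close> is a nonnegative quadratic form in
  \<open>u\<close> and \<open>v\<close>. The case \<open>c = 0\<close> is separate because a factor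
  \<open>c\<close> has to be cancelled.\<close>

lemma L2_cauchy_schwarz:
  assumes "X \<in> L2 M" "Y \<in> L2 M"
  shows "(\<integral>\<omega>. X \<omega> * Y \<omega> \<partial>M)\<^sup>2 \<le> (\<integral>\<omega>. (X \<omega>)\<^sup>2 \<partial>M) * (\<integral>\<omega>. (Y \<omega>)\<^sup>2 \<partial>M)"
proof -
  define a b c where "a = (\<integral>\<omega>. (X \<omega>)\<^sup>2 \<partial>M)" and "b = (\<integral>\<omega>. X \<omega> * Y \<omega> \<partial>M)"
    and "c = (\<integral>\<omega>. (Y \<omega>)\<^sup>2 \<partial>M)"
  have quad: "0 \<le> u\<^sup>2 * a + 2 * u * v * b + v\<^sup>2 * c" for u v
  proof -
    have "0 \<le> (\<integral>\<omega>. (u * X \<omega> + v * Y \<omega>)\<^sup>2 \<partial>M)" by simp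
    also have "(\<lambda>\<omega>. (u * X \<omega> + v * Y \<omega>)\<^sup>2)
      = (\<lambda>\<omega>. u\<^sup>2 * (X \<omega>)\<^sup>2 + 2 * u * v * (X \<omega> * Y \<omega>) + v\<^sup>2 * (Y \<omega>)\<^sup>2)"
      by (simp add: fun_eq_iff power2_eq_square algebra_simps)
    also have "(\<integral>\<omega>. u\<^sup>2 * (X \<omega>)\<^sup>2 + 2 * u * v * (X \<omega> * Y \<omega>) + v\<^sup>2 * (Y \<omega>)\<^sup>2 \<partial>M)
      = u\<^sup>2 * a + 2 * u * v * b + v\<^sup>2 * c"
      using assms L2_integrable_mult[OF assms] by (simp add: a_def b_def c_def L2_def)
    finally show ?thesis .
  qed
  have "a \<ge> 0" "c \<ge> 0" by (simp_all add: a_def c_def)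
  show ?thesis
  proof (cases "c = 0")
    case True
    have "b = 0"
    proof (rule ccontr)
      assume "b \<noteq> 0"
      \<comment> \<open>For \<open>c = 0\<close> the form is linear in \<open>v\<close>; this
        \<open>v\<close> gives it the value -1.\<close>
      with quad[of 1 "- (a + 1) / (2 * b)"] True show False
        by (simp add: field_simps)
    qed
    then show ?thesis using \<open>a \<ge> 0\<close> \<open>c \<ge> 0\<close> by (simp add: a_def b_def c_def)
  next
    case False
    with \<open>c \<ge> 0\<close> have "c > 0" by simp
    \<comment> \<open>The choice \<open>u = c\<close>, \<open>v = - b\<close> turns the form into
      \<open>c\<close> times the Cauchy-Schwarz gap.\<close>
    have "0 \<le> c * (a * c - b\<^sup>2)"
      using quad[of c "- b"] by (simp add: power2_eq_square algebra_simps)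
    then show ?thesis
      using \<open>c > 0\<close> by (simp add: zero_le_mult_iff a_def b_def c_def)
  qed
qed

text \<open>A substitute for the triangle inequality that avoids square roots. The factor 2 is
  harmless, as only null limits are derived from it.\<close>

lemma L2_integral_square_add_le:
  assumes "X \<in> L2 M" "Y \<in> L2 M"
  shows "(\<integral>\<omega>. (X \<omega> + Y \<omega>)\<^sup>2 \<partial>M) \<le> 2 * (\<integral>\<omega>. (X \<omega>)\<^sup>2 \<partial>M) + 2 * (\<integral>\<omega>. (Y \<omega>)\<^sup>2 \<partial>M)"
proof -
  have "(\<integral>\<omega>. (X \<omega> + Y \<omega>)\<^sup>2 \<partial>M) \<le> (\<integral>\<omega>. 2 * (X \<omega>)\<^sup>2 + 2 * (Y \<omega>)\<^sup>2 \<partial>M)"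
    using assms L2D(2)[OF L2_add[OF assms]]
    by (intro integral_mono)
       (auto simp: L2_def power2_sum add.commute intro: order_trans[OF sum_squares_bound])
  also have "\<dots> = 2 * (\<integral>\<omega>. (X \<omega>)\<^sup>2 \<partial>M) + 2 * (\<integral>\<omega>. (Y \<omega>)\<^sup>2 \<partial>M)"
    using assms by (simp add: L2_def)
  finally show ?thesis .
qed

section \<open>Calculus of mean-square limits\<close>

lemma tendsto_L2_add:
  assumes "tendsto_L2 M X Z F" "tendsto_L2 M X' Z' F"
  shows "tendsto_L2 M (\<lambda>i \<omega>. X i \<omega> + X' i \<omega>) (\<lambda>\<omega>. Z \<omega> + Z' \<omega>) F"
proof -
  have ev: "\<forall>\<^sub>F i in F. X i \<in> L2 M \<and> X' i \<in> L2 M" and Z: "Z \<in> L2 M" "Z' \<in> L2 M"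
    using assms by (auto simp: tendsto_L2_def eventually_conj_iff)
  have "((\<lambda>i. \<integral>\<omega>. (X i \<omega> + X' i \<omega> - (Z \<omega> + Z' \<omega>))\<^sup>2 \<partial>M) \<longlongrightarrow> 0) F"
  proof (rule tendsto_sandwich[where f = "\<lambda>_. 0"])
    show "\<forall>\<^sub>F i in F. (\<integral>\<omega>. (X i \<omega> + X' i \<omega> - (Z \<omega> + Z' \<omega>))\<^sup>2 \<partial>M)
        \<le> 2 * (\<integral>\<omega>. (X i \<omega> - Z \<omega>)\<^sup>2 \<partial>M) + 2 * (\<integral>\<omega>. (X' i \<omega> - Z' \<omega>)\<^sup>2 \<partial>M)"
      using ev
    proof eventually_elim
      case (elim i)
      then show ?case
        using L2_integral_square_add_le[OF L2_diff[of "X i" M Z] L2_diff[of "X' i" M Z']] Z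
        by (simp add: algebra_simps)
    qed
    show "((\<lambda>i. 2 * (\<integral>\<omega>. (X i \<omega> - Z \<omega>)\<^sup>2 \<partial>M) + 2 * (\<integral>\<omega>. (X' i \<omega> - Z' \<omega>)\<^sup>2 \<partial>M)) \<longlongrightarrow> 0) F"
      using assms unfolding tendsto_L2_def by (auto intro!: tendsto_eq_intros)
  qed auto
  then show ?thesis
    using ev Z by (auto simp: tendsto_L2_def intro: L2_add elim: eventually_mono)
qed

lemma tendsto_L2_cmult:
  assumes "tendsto_L2 M X Z F"
  shows "tendsto_L2 M (\<lambda>i \<omega>. c * X i \<omega>) (\<lambda>\<omega>. c * Z \<omega>) F"
proof -
  have "((\<lambda>i. c\<^sup>2 * (\<integral>\<omega>. (X i \<omega> - Z \<omega>)\<^sup>2 \<partial>M)) \<longlongrightarrow> 0) F"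
    using assms by (auto simp: tendsto_L2_def intro!: tendsto_eq_intros)
  also have "(\<lambda>i. c\<^sup>2 * (\<integral>\<omega>. (X i \<omega> - Z \<omega>)\<^sup>2 \<partial>M)) = (\<lambda>i. \<integral>\<omega>. (c * X i \<omega> - c * Z \<omega>)\<^sup>2 \<partial>M)"
    by (simp add: power_mult_distrib flip: right_diff_distrib integral_mult_right_zero)
  finally show ?thesis
    using assms by (auto simp: tendsto_L2_def intro: L2_cmult elim: eventually_mono)
qed

lemma tendsto_L2_const: "Z \<in> L2 M \<Longrightarrow> tendsto_L2 M (\<lambda>_. Z) Z F"
  by (auto simp: tendsto_L2_def)

lemma tendsto_L2_diff:
  assumes "tendsto_L2 M X Z F" "tendsto_L2 M X' Z' F"
  shows "tendsto_L2 M (\<lambda>i \<omega>. X i \<omega> - X' i \<omega>) (\<lambda>\<omega>. Z \<omega> - Z' \<omega>) F"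
  using tendsto_L2_add[OF assms(1) tendsto_L2_cmult[OF assms(2), of "-1"]] by simp

lemma tendsto_L2_sum:
  "(\<And>k. k \<in> A \<Longrightarrow> tendsto_L2 M (X k) (Z k) F) \<Longrightarrow>
    tendsto_L2 M (\<lambda>i \<omega>. \<Sum>k\<in>A. X k i \<omega>) (\<lambda>\<omega>. \<Sum>k\<in>A. Z k \<omega>) F"
  by (induction A rule: infinite_finite_induct)
     (auto intro: tendsto_L2_const L2_zero tendsto_L2_add)

text \<open>The model equation and the projection are fixed only up to null sets, so limits must be
  moved along almost-everywhere equality. Membership of \<open>X'\<close> and \<open>Z'\<close> in
  \<open>L2 M\<close> is assumed because measurability can get lost when the measure is not
  complete.\<close>

lemma tendsto_L2_cong_AE:
  assumes "tendsto_L2 M X Z F"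
    and "\<forall>\<^sub>F i in F. X' i \<in> L2 M \<and> (AE \<omega> in M. X' i \<omega> = X i \<omega>)"
    and Z': "Z' \<in> L2 M" "AE \<omega> in M. Z' \<omega> = Z \<omega>"
  shows "tendsto_L2 M X' Z' F"
proof -
  have ev: "\<forall>\<^sub>F i in F. (\<integral>\<omega>. (X i \<omega> - Z \<omega>)\<^sup>2 \<partial>M) = (\<integral>\<omega>. (X' i \<omega> - Z' \<omega>)\<^sup>2 \<partial>M)"
    using assms(2) assms(1)[unfolded tendsto_L2_def, THEN conjunct1]
  proof eventually_elim
    case (elim i)
    have [measurable]: "X' i \<in> borel_measurable M" "Z' \<in> borel_measurable M"
        "X i \<in> borel_measurable M" "Z \<in> borel_measurable M"
      using elim Z' assms(1) by (auto simp: L2_def tendsto_L2_def)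
    have "AE \<omega> in M. X' i \<omega> = X i \<omega>" using elim by simp
    then show ?case
      using Z'(2) by (intro integral_cong_AE) (measurable, auto)
  qed
  have "((\<lambda>i. \<integral>\<omega>. (X i \<omega> - Z \<omega>)\<^sup>2 \<partial>M) \<longlongrightarrow> 0) F"
    using assms(1) by (simp add: tendsto_L2_def)
  then have "((\<lambda>i. \<integral>\<omega>. (X' i \<omega> - Z' \<omega>)\<^sup>2 \<partial>M) \<longlongrightarrow> 0) F"
    using ev by (rule Lim_transform_eventually)
  then show ?thesis
    using assms(2) Z' by (auto simp: tendsto_L2_def elim: eventually_mono)
qed

text \<open>Identities between partial sums over \<open>{n..t}\<close> hold only once
  \<open>n\<close> is small enough; this version carries them to the limit.\<close>

lemma tendsto_L2_cong:
  assumes "\<forall>\<^sub>F i in F. X i = X' i"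
  shows "tendsto_L2 M X Z F \<longleftrightarrow> tendsto_L2 M X' Z F"
proof -
  have "tendsto_L2 M X' Z F" if "tendsto_L2 M X Z F" "\<forall>\<^sub>F i in F. X i = X' i"
    for X X'
  proof (rule tendsto_L2_cong_AE[OF that(1)])
    have "\<forall>\<^sub>F i in F. X i \<in> L2 M" using that(1) by (simp add: tendsto_L2_def)
    then show "\<forall>\<^sub>F i in F. X' i \<in> L2 M \<and> (AE \<omega> in M. X' i \<omega> = X i \<omega>)"
      using that(2) by eventually_elim simp
  qed (use that in \<open>auto simp: tendsto_L2_def\<close>)
  from this[of X X'] this[of X' X] show ?thesis
    using assms by (auto simp: eq_commute)
qed

lemma tendsto_L2_compose:
  assumes "tendsto_L2 M X Z F" "filterlim f F G"
  shows "tendsto_L2 M (\<lambda>i. X (f i)) Z G"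
  using assms filterlim_compose[OF _ assms(2)] eventually_compose_filterlim[OF _ assms(2)]
  unfolding tendsto_L2_def by blast

lemma tendsto_L2_mult_null:
  assumes "(a \<longlongrightarrow> 0) F" "\<forall>\<^sub>F i in F. X i \<in> L2 M \<and> (\<integral>\<omega>. (X i \<omega>)\<^sup>2 \<partial>M) \<le> B"
  shows "tendsto_L2 M (\<lambda>i \<omega>. a i * X i \<omega>) (\<lambda>\<omega>. 0) F"
proof -
  have "((\<lambda>i. \<integral>\<omega>. (a i * X i \<omega> - 0)\<^sup>2 \<partial>M) \<longlongrightarrow> 0) F"
  proof (rule tendsto_sandwich[where f = "\<lambda>_. 0"])
    show "\<forall>\<^sub>F i in F. (\<integral>\<omega>. (a i * X i \<omega> - 0)\<^sup>2 \<partial>M) \<le> (a i)\<^sup>2 * B"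
      using assms(2)
      by eventually_elim (simp add: power_mult_distrib mult_left_mono)
    show "((\<lambda>i. (a i)\<^sup>2 * B) \<longlongrightarrow> 0) F"
      using assms(1) by (auto intro!: tendsto_eq_intros)
  qed auto
  then show ?thesis
    using assms(2) by (auto simp: tendsto_L2_def intro: L2_cmult L2_zero elim: eventually_mono)
qed

lemma (in finite_measure) tendsto_L2_real:
  assumes "(a \<longlongrightarrow> c) F"
  shows "tendsto_L2 M (\<lambda>i \<omega>. a i) (\<lambda>\<omega>. c) F"
proof -
  have "((\<lambda>i. a i - c) \<longlongrightarrow> 0) F" using assms by (simp add: LIM_zero)
  then have "tendsto_L2 M (\<lambda>i \<omega>. (a i - c) * 1) (\<lambda>\<omega>. 0) F"
    by (rule tendsto_L2_mult_null[where B = "measure M (space M)"]) (simp add: L2_const)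
  from tendsto_L2_add[OF this tendsto_L2_const[OF L2_const[of c]]] show ?thesis
    by simp
qed

text \<open>Continuity of the inner product: Cauchy-Schwarz applied to \<open>X i - Z\<close> and
  \<open>W\<close>. Orthogonality thereby survives mean-square limits.\<close>

lemma tendsto_L2_inner:
  assumes "tendsto_L2 M X Z F" "W \<in> L2 M"
  shows "((\<lambda>i. \<integral>\<omega>. X i \<omega> * W \<omega> \<partial>M) \<longlongrightarrow> (\<integral>\<omega>. Z \<omega> * W \<omega> \<partial>M)) F"
proof -
  have Z: "Z \<in> L2 M" and lim: "((\<lambda>i. \<integral>\<omega>. (X i \<omega> - Z \<omega>)\<^sup>2 \<partial>M) \<longlongrightarrow> 0) F"
    using assms by (auto simp: tendsto_L2_def)
  have "((\<lambda>i. ((\<integral>\<omega>. X i \<omega> * W \<omega> \<partial>M) - (\<integral>\<omega>. Z \<omega> * W \<omega> \<partial>M))\<^sup>2) \<longlongrightarrow> 0) F"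
  proof (rule tendsto_sandwich[where f = "\<lambda>_. 0"])
    show "((\<lambda>i. (\<integral>\<omega>. (X i \<omega> - Z \<omega>)\<^sup>2 \<partial>M) * (\<integral>\<omega>. (W \<omega>)\<^sup>2 \<partial>M)) \<longlongrightarrow> 0) F"
      using lim by (auto intro!: tendsto_eq_intros)
    have "\<forall>\<^sub>F i in F. X i \<in> L2 M" using assms by (simp add: tendsto_L2_def)
    then show "\<forall>\<^sub>F i in F. ((\<integral>\<omega>. X i \<omega> * W \<omega> \<partial>M) - (\<integral>\<omega>. Z \<omega> * W \<omega> \<partial>M))\<^sup>2
        \<le> (\<integral>\<omega>. (X i \<omega> - Z \<omega>)\<^sup>2 \<partial>M) * (\<integral>\<omega>. (W \<omega>)\<^sup>2 \<partial>M)"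
    proof eventually_elim
      case (elim i)
      then show ?case
        using L2_cauchy_schwarz[OF L2_diff[OF elim Z] assms(2)]
          L2_integrable_mult[OF elim assms(2)] L2_integrable_mult[OF Z assms(2)]
        by (simp add: left_diff_distrib)
    qed
  qed auto
  then have "((\<lambda>i. (\<integral>\<omega>. X i \<omega> * W \<omega> \<partial>M) - (\<integral>\<omega>. Z \<omega> * W \<omega> \<partial>M)) \<longlongrightarrow> 0) F"
    
    using tendsto_real_sqrt[of _ 0] by (fastforce simp: tendsto_rabs_zero_iff)
  then show ?thesis by (simp add: LIM_zero_iff)
qed

lemma integral_square_sum_orthogonal:
  assumes "finite A" "\<And>i. i \<in> A \<Longrightarrow> X i \<in> L2 M"
    and "\<And>i j. i \<in> A \<Longrightarrow> j \<in> A \<Longrightarrow> i \<noteq> j \<Longrightarrow> (\<integral>\<omega>. X i \<omega> * X j \<omega> \<partial>M) = 0"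
  shows "(\<integral>\<omega>. (\<Sum>i\<in>A. c i * X i \<omega>)\<^sup>2 \<partial>M) = (\<Sum>i\<in>A. (c i)\<^sup>2 * (\<integral>\<omega>. (X i \<omega>)\<^sup>2 \<partial>M))"
proof -
  have "(\<integral>\<omega>. (\<Sum>i\<in>A. c i * X i \<omega>)\<^sup>2 \<partial>M)
      = (\<integral>\<omega>. (\<Sum>i\<in>A. \<Sum>j\<in>A. c i * c j * (X i \<omega> * X j \<omega>)) \<partial>M)"
    by (simp add: power2_eq_square sum_product mult_ac)
  also have "\<dots> = (\<Sum>i\<in>A. \<Sum>j\<in>A. c i * c j * (\<integral>\<omega>. X i \<omega> * X j \<omega> \<partial>M))"
    using assms(2) by (simp add: Bochner_Integration.integral_sum Bochner_Integration.integrable_sum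
      L2_integrable_mult)
  also have "\<dots> = (\<Sum>i\<in>A. (c i)\<^sup>2 * (\<integral>\<omega>. (X i \<omega>)\<^sup>2 \<partial>M))"
  proof (intro sum.cong refl)
    fix i assume "i \<in> A"
    then have "(\<Sum>j\<in>A. c i * c j * (\<integral>\<omega>. X i \<omega> * X j \<omega> \<partial>M))
        = (\<Sum>j\<in>A. if i = j then (c i)\<^sup>2 * (\<integral>\<omega>. (X i \<omega>)\<^sup>2 \<partial>M) else 0)"
      using assms(3) by (intro sum.cong) (auto simp: power2_eq_square)
    then show "(\<Sum>j\<in>A. c i * c j * (\<integral>\<omega>. X i \<omega> * X j \<omega> \<partial>M)) = (c i)\<^sup>2 * (\<integral>\<omega>. (X i \<omega>)\<^sup>2 \<partial>M)"
      using \<open>i \<in> A\<close> \<open>finite A\<close> by simp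
  qed
  finally show ?thesis .
qed

section \<open>Banded Hessenbergians and summation by parts\<close>

text \<open>Indexed by size and starting time rather than by two times: trailing diagonal blocks are
  then again of this form, with smaller size and later start.\<close>

definition hess_mat :: "nat \<Rightarrow> (nat \<Rightarrow> int \<Rightarrow> real) \<Rightarrow> nat \<Rightarrow> int \<Rightarrow> real mat" where
  "hess_mat p c n s = Matrix.mat n n (\<lambda>(i, j).
     if j \<le> i \<and> i - j < p then c (i - j + 1) (s + int i + 1)
     else if j = i + 1 then -1 else 0)"

lemma hessenbergian_eq_det:
  "hessenbergian p c t s = (if s \<le> t then Determinant.det (hess_mat p c (nat (t - s)) s) else 0)"
  by (auto simp: hessenbergian_def hess_mat_def det_dim_zero)

lemma hessenbergian_refl [simp]: "hessenbergian p c t t = 1"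
  and hessenbergian_eq_0: "t < s \<Longrightarrow> hessenbergian p c t s = 0"
  by (simp_all add: hessenbergian_def)

text \<open>Once the first column is gone, the superdiagonal entries -1 of the rows above row
  \<open>i\<close> sit on the diagonal, and those rows vanish to the right of it. The minor is block
  lower triangular: a triangular block of determinant \<open>(-1) ^ i\<close>, and the Hessenbergian
  matrix that starts after the deleted row.\<close>

lemma det_mat_delete_hess_mat:
  assumes "i < n"
  shows "Determinant.det (mat_delete (hess_mat p c n s) i 0)
    = (-1) ^ i * Determinant.det (hess_mat p c (n - Suc i) (s + int i + 1))"
proof -
  let ?m = "n - Suc i"
  define A where "A = Matrix.mat i i (\<lambda>(a, b). hess_mat p c n s $$ (a, Suc b))"
  define C where "C = Matrix.mat ?m i (\<lambda>(a, b). hess_mat p c n s $$ (Suc (a + i), Suc b))"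
  have "mat_delete (hess_mat p c n s) i 0
      = four_block_mat A (0\<^sub>m i ?m) C (hess_mat p c ?m (s + int i + 1))"
  proof (rule eq_matI)
    fix a b
    assume "a < dim_row (four_block_mat A (0\<^sub>m i ?m) C (hess_mat p c ?m (s + int i + 1)))"
      and "b < dim_col (four_block_mat A (0\<^sub>m i ?m) C (hess_mat p c ?m (s + int i + 1)))"
    then have ab: "a < n - 1" "b < n - 1"
      using assms by (auto simp: A_def hess_mat_def)
    have "mat_delete (hess_mat p c n s) i 0 $$ (a, b)
        = hess_mat p c n s $$ (if a < i then a else Suc a, Suc b)"
      using ab by (simp add: mat_delete_def hess_mat_def)
    also have "\<dots> = four_block_mat A (0\<^sub>m i ?m) C (hess_mat p c ?m (s + int i + 1)) $$ (a, b)"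
      using ab assms by (auto simp: A_def C_def hess_mat_def algebra_simps of_nat_diff Suc_diff_le)
    finally show "mat_delete (hess_mat p c n s) i 0 $$ (a, b)
        = four_block_mat A (0\<^sub>m i ?m) C (hess_mat p c ?m (s + int i + 1)) $$ (a, b)" .
  qed (use assms in \<open>auto simp: A_def hess_mat_def\<close>)
  also have "Determinant.det \<dots> = Determinant.det A * Determinant.det (hess_mat p c ?m (s + int i + 1))"
    by (rule det_four_block_mat_upper_right_zero) (auto simp: A_def C_def hess_mat_def)
  also have "Determinant.det A = prod_list (diag_mat A)"
    by (rule det_lower_triangular[of i]) (use assms in \<open>auto simp: A_def hess_mat_def\<close>)
  also have "diag_mat A = replicate i (-1)"
    by (rule nth_equalityI) (use assms in \<open>auto simp: A_def hess_mat_def diag_mat_def\<close>)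
  finally show ?thesis by simp
qed

text \<open>Laplace expansion along the first column. The recurrence runs in the second argument,
  with coefficients taken at the later times \<open>s + m\<close>, which is what summation by parts
  against the kernel needs.\<close>

lemma hessenbergian_rec:
  assumes "s < t"
  shows "hessenbergian p c t s = (\<Sum>m=1..p. c m (s + int m) * hessenbergian p c t (s + int m))"
proof -
  define n where "n = nat (t - s)"
  have n: "0 < n" "t = s + int n" using assms by (auto simp: n_def)
  have cof: "hess_mat p c n s $$ (i, 0) * cofactor (hess_mat p c n s) i 0
      = (if i < p then c (i + 1) (s + int (i + 1)) * hessenbergian p c t (s + int (i + 1)) else 0)"
    if "i < n" for i
  proof -
    have "nat (int n - (1 + int i)) = n - Suc i" using that by simp
    \<comment> \<open>The sign of the cofactor cancels the determinant of the triangular block in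
      the minor.\<close>
    moreover have "(-1) ^ i * ((-1) ^ i * x) = (x :: real)" for x
      by (simp flip: mult.assoc power_mult_distrib)
    ultimately show ?thesis
      using that n by (simp add: cofactor_def det_mat_delete_hess_mat hessenbergian_eq_det)
        (simp add: hess_mat_def algebra_simps)
  qed
  have "hessenbergian p c t s = (\<Sum>i<n. hess_mat p c n s $$ (i, 0) * cofactor (hess_mat p c n s) i 0)"
    using assms n(1) laplace_expansion_column[of "hess_mat p c n s" n 0]
    by (simp add: hessenbergian_eq_det flip: n_def) (simp add: hess_mat_def)
  also have "\<dots> = (\<Sum>i<n. if i < p then c (i + 1) (s + int (i + 1)) * hessenbergian p c t (s + int (i + 1)) else 0)"
    by (intro sum.cong) (auto simp: cof)
  \<comment> \<open>Passing from \<open>n\<close> rows to \<open>p\<close> bands is free in both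
    directions: entries below the band are zero, and for \<open>i \<ge> n\<close> the starting time
    exceeds \<open>t\<close>.\<close>
  also have "\<dots> = (\<Sum>i<p. c (i + 1) (s + int (i + 1)) * hessenbergian p c t (s + int (i + 1)))"
    by (intro sum.mono_neutral_cong) (auto simp: n hessenbergian_eq_0)
  also have "\<dots> = (\<Sum>m=1..p. c m (s + int m) * hessenbergian p c t (s + int m))"
    by (rule sum.reindex_bij_witness[of _ "\<lambda>m. m - 1" Suc]) auto
  finally show ?thesis .
qed

text \<open>\<open>vtheta\<close> is built from the negated \<theta>, so the recurrence moves
  everything to one side; at \<open>j = r\<close> only the diagonal value 1 remains. In effect the
  kernel inverts the moving-average operator.\<close>

lemma vtheta_rec:
  "j \<le> r \<Longrightarrow> vtheta q \<theta> r j + (\<Sum>l=1..q. vtheta q \<theta> r (j + int l) * \<theta> l (j + int l)) = (if j = r then 1 else 0)"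
  unfolding vtheta_def
  by (auto simp: hessenbergian_rec[of j r] hessenbergian_eq_0 sum_negf mult.commute)

text \<open>Both sides run over the triangle \<open>1 \<le> k \<le> l \<le> q\<close>, with
  \<open>l = k - 1 + r\<close>; the right side has the index layout of
  \<open>boundary_term\<close>.\<close>

lemma sum_triangle_reindex:
  fixes G :: "nat \<Rightarrow> nat \<Rightarrow> 'b::comm_monoid_add"
  shows "(\<Sum>l=1..q. \<Sum>k=1..l. G l k) = (\<Sum>k=1..q. \<Sum>r=1..q + 1 - k. G (k - 1 + r) k)"
  unfolding sum.Sigma[OF finite_atLeastAtMost ballI[OF finite_atLeastAtMost]]
  by (rule sum.reindex_bij_witness[of _ "\<lambda>(k, r). (k - 1 + r, k)" "\<lambda>(l, k). (k, l + 1 - k)"]) auto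

text \<open>Discrete summation by parts. Substituting \<open>i = j - l\<close> lag by lag transfers
  the lags from \<open>x\<close> to the kernel; the indices below \<open>n\<close> are left over and
  form the boundary term. It serves both for \<theta> with the errors and for \<phi> with the
  observations.\<close>

lemma sum_shift_boundary_term:
  assumes f: "\<And>j. r < j \<Longrightarrow> g r j = 0" and n: "n \<le> r + 1"
  shows "(\<Sum>j\<in>{n..r}. g r j * (\<Sum>l=1..q. c l j * x (j - int l) \<omega>))
    = (\<Sum>i\<in>{n..r}. (\<Sum>l=1..q. g r (i + int l) * c l (i + int l)) * x i \<omega>)
      + boundary_term q c g x r (n - 1) \<omega>"
proof -
  define F where "F l i = g r (i + int l) * c l (i + int l) * x i \<omega>" for l i
  have shift: "(\<Sum>j\<in>{n..r}. g r j * (c l j * x (j - int l) \<omega>))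
      = (\<Sum>i\<in>{n..r}. F l i) + (\<Sum>k=1..l. F l (n - int k))" for l
  proof -
    have "(\<Sum>j\<in>{n..r}. g r j * (c l j * x (j - int l) \<omega>)) = (\<Sum>i\<in>{n - int l..r - int l}. F l i)"
      by (rule sum.reindex_bij_witness[of _ "\<lambda>i. i + int l" "\<lambda>j. j - int l"])
         (auto simp: F_def mult.assoc)
    \<comment> \<open>The added indices have \<open>i + l > r\<close>, where the kernel
      vanishes.\<close>
    also have "\<dots> = (\<Sum>i\<in>{n..r} \<union> {n - int l..n - 1}. F l i)"
      using n by (intro sum.mono_neutral_left) (auto simp: F_def f)
    also have "\<dots> = (\<Sum>i\<in>{n..r}. F l i) + (\<Sum>i\<in>{n - int l..n - 1}. F l i)"
      by (intro sum.union_disjoint) auto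
    also have "(\<Sum>i\<in>{n - int l..n - 1}. F l i) = (\<Sum>k=1..l. F l (n - int k))"
      by (rule sum.reindex_bij_witness[of _ "\<lambda>k. n - int k" "\<lambda>i. nat (n - i)"]) auto
    finally show ?thesis .
  qed
  have "(\<Sum>j\<in>{n..r}. g r j * (\<Sum>l=1..q. c l j * x (j - int l) \<omega>))
      = (\<Sum>l=1..q. \<Sum>j\<in>{n..r}. g r j * (c l j * x (j - int l) \<omega>))"
    unfolding sum_distrib_left by (rule sum.swap)
  also have "\<dots> = (\<Sum>l=1..q. \<Sum>i\<in>{n..r}. F l i) + (\<Sum>l=1..q. \<Sum>k=1..l. F l (n - int k))"
    by (simp add: shift sum.distrib)
  also have "(\<Sum>l=1..q. \<Sum>i\<in>{n..r}. F l i)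
      = (\<Sum>i\<in>{n..r}. (\<Sum>l=1..q. g r (i + int l) * c l (i + int l)) * x i \<omega>)"
    unfolding F_def sum_distrib_right by (rule sum.swap)
  \<comment> \<open>The boundary sits at \<open>u = n - 1\<close>: the leftover index
    \<open>n - k\<close> is \<open>u + 1 - k\<close>, and for \<open>l = k - 1 + r\<close> the
    kernel argument \<open>n - k + l\<close> is \<open>u + r\<close>, where \<open>r\<close> is the
    inner index of the triangle.\<close>
  also have "(\<Sum>l=1..q. \<Sum>k=1..l. F l (n - int k)) = boundary_term q c g x r (n - 1) \<omega>"
    unfolding sum_triangle_reindex boundary_term_def sum_distrib_right
    by (intro sum.cong refl) (auto simp: F_def of_nat_diff algebra_simps)
  finally show ?thesis .
qed

section \<open>One-sided series over the integers\<close>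

lemma summable_on_int_atMost_tendsto:
  fixes f :: "int \<Rightarrow> 'b::{comm_monoid_add, t2_space}"
  assumes "f summable_on {..r}"
  shows "((\<lambda>n. \<Sum>j\<in>{n..r}. f j) \<longlongrightarrow> infsum f {..r}) at_bot"
proof -
  have "(sum f \<longlongrightarrow> infsum f {..r}) (finite_subsets_at_top {..r})"
    using has_sum_infsum[OF assms] by (simp add: has_sum_def)
  \<comment> \<open>The intervals \<open>{n..r}\<close> exhaust \<open>{..r}\<close>, so the
    unconditional limit over finite sets specialises to them.\<close>
  moreover have "filterlim (\<lambda>n. {n..r}) (finite_subsets_at_top {..r}) at_bot"
    unfolding filterlim_finite_subsets_at_top
  proof (intro allI impI)
    fix X assume X: "finite X \<and> X \<subseteq> {..r}"
    \<comment> \<open>Inserting \<open>r\<close> keeps the minimum defined when \<open>X\<close> is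
      empty.\<close>
    have "\<forall>\<^sub>F n in at_bot. n \<le> Min (insert r X)" by simp
    then show "\<forall>\<^sub>F n in at_bot. finite {n..r} \<and> X \<subseteq> {n..r} \<and> {n..r} \<subseteq> {..r}"
      by eventually_elim (use X in auto)
  qed
  ultimately show ?thesis by (rule filterlim_compose)
qed

lemma filterlim_int_add_at_bot: "filterlim (\<lambda>n. n + c :: int) at_bot at_bot"
  unfolding filterlim_at_bot
proof
  fix Z :: int
  show "\<forall>\<^sub>F n in at_bot. n + c \<le> Z"
    using eventually_le_at_bot[of "Z - c"] by eventually_elim simp
qed

text \<open>Consecutive partial sums have the same limit and differ by one term.\<close>

lemma summable_on_int_atMost_tendsto_0:
  fixes f :: "int \<Rightarrow> real"
  assumes "f summable_on {..r}"
  shows "(f \<longlongrightarrow> 0) at_bot"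
proof -
  let ?S = "\<lambda>n. \<Sum>j\<in>{n..r}. f j"
  have "((\<lambda>n. ?S n - ?S (n + 1)) \<longlongrightarrow> infsum f {..r} - infsum f {..r}) at_bot"
    using summable_on_int_atMost_tendsto[OF assms]
    by (intro tendsto_diff) (auto intro: filterlim_compose filterlim_int_add_at_bot)
  moreover have "\<forall>\<^sub>F n in at_bot. ?S n - ?S (n + 1) = f n"
    using eventually_le_at_bot[of r]
  proof eventually_elim
    case (elim n)
    then have "{n..r} = insert n {n+1..r}" by auto
    then show ?case by simp
  qed
  ultimately show ?thesis by (simp add: tendsto_cong)
qed

text \<open>The number of summands is fixed and finite; in each, bounded coefficients times a
  vanishing kernel multiply a variable of bounded mean square. The bound is asked only up to time
  \<open>s\<close>, since \<open>u\<close> tends to minus infinity.\<close>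

lemma tendsto_L2_boundary_term:
  assumes bdd: "\<forall>l\<in>{1..q}. bounded (range (c l))" and g: "(g r \<longlongrightarrow> 0) at_bot"
    and x: "\<And>t. t \<le> s \<Longrightarrow> x t \<in> L2 M \<and> (\<integral>\<omega>. (x t \<omega>)\<^sup>2 \<partial>M) \<le> B"
  shows "tendsto_L2 M (\<lambda>u. boundary_term q c g x r u) (\<lambda>\<omega>. 0) at_bot"
proof -
  have coeff: "((\<lambda>u. c l (u + int k) * g r (u + int k)) \<longlongrightarrow> 0) at_bot" if l: "l \<in> {1..q}" for k l
  proof -
    have "bounded (range (c l))" using bdd l by blast
    then obtain K where K: "\<And>j. \<bar>c l j\<bar> \<le> K"
      by (auto simp: bounded_iff)
    have "((\<lambda>u. g r (u + int k)) \<longlongrightarrow> 0) at_bot"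
      using g filterlim_int_add_at_bot by (rule filterlim_compose)
    then show ?thesis
      by (rule tendsto_0_le[where K = K])
         (auto simp: abs_mult mult.commute[of "\<bar>c _ _\<bar>"] intro!: always_eventually mult_left_mono K)
  qed
  have "tendsto_L2 M (\<lambda>u \<omega>. \<Sum>m=1..q. (\<Sum>k=1..q + 1 - m. c (m - 1 + k) (u + int k) * g r (u + int k))
      * x (u + 1 - int m) \<omega>) (\<lambda>\<omega>. \<Sum>m=1..q. 0) at_bot"
  proof (intro tendsto_L2_sum tendsto_L2_mult_null)
    fix m assume m: "m \<in> {1..q}"
    show "((\<lambda>u. \<Sum>k=1..q + 1 - m. c (m - 1 + k) (u + int k) * g r (u + int k)) \<longlongrightarrow> 0) at_bot"
      by (rule tendsto_null_sum, rule coeff) (use m in auto)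
    show "\<forall>\<^sub>F u in at_bot. x (u + 1 - int m) \<in> L2 M \<and> (\<integral>\<omega>. (x (u + 1 - int m) \<omega>)\<^sup>2 \<partial>M) \<le> B"
      using eventually_le_at_bot[of "s - 1"]
      by eventually_elim (use x in auto)
  qed
  then show ?thesis by (simp add: boundary_term_def[abs_def])
qed

section \<open>Closed subspaces and the past of a process\<close>

lemma closed_L2_subspaceD:
  assumes "closed_L2_subspace M S"
  shows "S \<subseteq> L2 M" "(\<lambda>\<omega>. 0) \<in> S"
    "X \<in> S \<Longrightarrow> Y \<in> S \<Longrightarrow> (\<lambda>\<omega>. X \<omega> + Y \<omega>) \<in> S"
    "X \<in> S \<Longrightarrow> (\<lambda>\<omega>. a * X \<omega>) \<in> S"
    "(\<And>n. V n \<in> S) \<Longrightarrow> tendsto_L2 M V Z sequentially \<Longrightarrow> Z \<in> S"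
  using assms unfolding closed_L2_subspace_def by blast+

lemma closed_L2_subspace_diff:
  assumes "closed_L2_subspace M S" "X \<in> S" "Y \<in> S"
  shows "(\<lambda>\<omega>. X \<omega> - Y \<omega>) \<in> S"
  using closed_L2_subspaceD(3)[OF assms(1,2) closed_L2_subspaceD(4)[OF assms(1,3), of "-1"]] by simp

lemma closed_L2_subspace_sum:
  "closed_L2_subspace M S \<Longrightarrow> (\<And>i. i \<in> A \<Longrightarrow> X i \<in> S) \<Longrightarrow> (\<lambda>\<omega>. \<Sum>i\<in>A. X i \<omega>) \<in> S"
  by (induction A rule: infinite_finite_induct)
     (auto intro: closed_L2_subspaceD)

text \<open>Closedness is stated for sequences; the limit at minus infinity is sampled along
  \<open>- int n\<close>.\<close>

lemma closed_L2_subspace_at_bot: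
  fixes V :: "int \<Rightarrow> 'a \<Rightarrow> real"
  assumes "closed_L2_subspace M S" "\<And>n. V n \<in> S" "tendsto_L2 M V Z at_bot"
  shows "Z \<in> S"
proof (rule closed_L2_subspaceD(5)[OF assms(1,2)])
  have "filterlim (\<lambda>n. - int n) at_bot sequentially"
    unfolding filterlim_at_bot
  proof
    fix Z :: int
    show "\<forall>\<^sub>F n in sequentially. - int n \<le> Z"
      using eventually_ge_at_top[of "nat (- Z)"] by eventually_elim auto
  qed
  then show "tendsto_L2 M (\<lambda>n. V (- int n)) Z sequentially"
    using tendsto_L2_compose[OF assms(3)] by blast
qed

text \<open>Continuity of the inner product gives closedness. By minimality of
  \<open>past_space\<close>, orthogonality then needs checking only on the observations and the
  constants.\<close>

lemma closed_L2_subspace_orthogonal: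
  assumes W: "W \<in> L2 M"
  shows "closed_L2_subspace M {Z \<in> L2 M. (\<integral>\<omega>. W \<omega> * Z \<omega> \<partial>M) = 0}"
  unfolding closed_L2_subspace_def
proof (intro conjI allI ballI impI)
  fix V Z
  assume "(\<forall>n::nat. V n \<in> {Z \<in> L2 M. (\<integral>\<omega>. W \<omega> * Z \<omega> \<partial>M) = 0}) \<and> tendsto_L2 M V Z sequentially"
  then have V: "\<And>n. (\<integral>\<omega>. V n \<omega> * W \<omega> \<partial>M) = 0" and lim: "tendsto_L2 M V Z sequentially"
    by (auto simp: mult.commute)
  have "(\<integral>\<omega>. Z \<omega> * W \<omega> \<partial>M) = 0"
    using tendsto_L2_inner[OF lim W] by (simp add: V LIMSEQ_const_iff)
  then show "Z \<in> {Z \<in> L2 M. (\<integral>\<omega>. W \<omega> * Z \<omega> \<partial>M) = 0}"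
    using lim by (simp add: tendsto_L2_def mult.commute)
qed (use L2_integrable_mult[OF W] in \<open>auto intro: L2_zero L2_add L2_cmult
  simp: distrib_left mult.left_commute\<close>)

text \<open>The orthogonal complement of the zero function is everything.\<close>

lemma closed_L2_subspace_L2: "closed_L2_subspace M (L2 M)"
  using closed_L2_subspace_orthogonal[OF L2_zero, of M] by simp

section \<open>The past of a square-integrable process\<close>

locale L2_process = prob_space M for M :: "'a measure" +
  fixes y :: "int \<Rightarrow> 'a \<Rightarrow> real"
  assumes y_L2: "y t \<in> L2 M"
begin

text \<open>Every closure property passes to an intersection; inclusion in \<open>L2 M\<close> holds
  because \<open>L2 M\<close> itself belongs to the intersected family.\<close>

lemma closed_past_space: "closed_L2_subspace M (past_space M y s)"
proof -
  have "past_space M y s \<subseteq> L2 M"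
    unfolding past_space_def using closed_L2_subspace_L2 y_L2 L2_const by blast
  moreover have "Z \<in> past_space M y s"
    if "\<And>n. V n \<in> past_space M y s" "tendsto_L2 M V Z sequentially" for V Z
    unfolding past_space_def
  proof
    fix S assume S: "S \<in> {S. closed_L2_subspace M S \<and> (\<forall>j\<le>s. y j \<in> S) \<and> (\<forall>c. (\<lambda>\<omega>. c) \<in> S)}"
    then have "V n \<in> S" for n using that(1)[of n] by (auto simp: past_space_def)
    then show "Z \<in> S" using closed_L2_subspaceD(5)[of M S V Z] S that(2) by blast
  qed
  moreover have "(\<lambda>\<omega>. 0) \<in> past_space M y s"
    by (simp add: past_space_def closed_L2_subspace_def)
  moreover have "(\<lambda>\<omega>. X \<omega> + Y \<omega>) \<in> past_space M y s"
    if "X \<in> past_space M y s" "Y \<in> past_space M y s" for X Y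
    using that by (simp add: past_space_def closed_L2_subspace_def)
  moreover have "(\<lambda>\<omega>. c * X \<omega>) \<in> past_space M y s"
    if "X \<in> past_space M y s" for c X
    using that by (simp add: past_space_def closed_L2_subspace_def)
  ultimately show ?thesis
    unfolding closed_L2_subspace_def by blast
qed

lemma past_space_least:
  "closed_L2_subspace M S \<Longrightarrow> (\<And>j. j \<le> s \<Longrightarrow> y j \<in> S) \<Longrightarrow> (\<And>c. (\<lambda>\<omega>. c) \<in> S) \<Longrightarrow> past_space M y s \<subseteq> S"
  unfolding past_space_def by auto

lemma y_in_past_space: "j \<le> s \<Longrightarrow> y j \<in> past_space M y s"
  and const_in_past_space: "(\<lambda>\<omega>. c) \<in> past_space M y s"
  unfolding past_space_def by auto

lemma past_space_mono: "r \<le> s \<Longrightarrow> past_space M y r \<subseteq> past_space M y s"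
  by (intro past_space_least closed_past_space y_in_past_space const_in_past_space) auto

lemma space_past_algebra: "space (past_algebra M y s) = space M"
  by (simp add: past_algebra_def space_measure_of_conv)

lemma sets_past_algebra:
  "sets (past_algebra M y s)
    = sigma_sets (space M) (\<Union>j\<in>{..s}. {y j -` A \<inter> space M |A. A \<in> sets borel})"
  unfolding past_algebra_def by (rule sets_measure_of) auto

lemma subalgebra_past_algebra_mono: "r \<le> s \<Longrightarrow> subalgebra (past_algebra M y s) (past_algebra M y r)"
  unfolding subalgebra_def space_past_algebra sets_past_algebra
  by (intro conjI refl sigma_sets_mono') fastforce

lemma subalgebra_past_algebra: "subalgebra M (past_algebra M y s)"
  unfolding subalgebra_def space_past_algebra sets_past_algebra
  using y_L2 by (auto simp: L2_def intro!: sets.sigma_sets_subset measurable_sets)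

lemma measurable_past_algebra: "j \<le> s \<Longrightarrow> y j \<in> borel_measurable (past_algebra M y s)"
  by (rule measurableI) (auto simp: space_past_algebra sets_past_algebra)

lemma cond_exp_zero_orthogonal:
  assumes W: "W \<in> L2 M" and Z: "Z \<in> L2 M" "Z \<in> borel_measurable (past_algebra M y s)"
    and zero: "AE \<omega> in M. real_cond_exp M (past_algebra M y s) W \<omega> = 0"
  shows "(\<integral>\<omega>. W \<omega> * Z \<omega> \<partial>M) = 0"
proof -
  interpret finite_measure_subalgebra M "past_algebra M y s"
    by unfold_locales (rule subalgebra_past_algebra)
  have "(\<integral>\<omega>. Z \<omega> * W \<omega> \<partial>M) = (\<integral>\<omega>. Z \<omega> * real_cond_exp M (past_algebra M y s) W \<omega> \<partial>M)"
    using L2_integrable_mult[OF Z(1) W] Z(2) W by (intro real_cond_exp_intg(2)[symmetric]) (auto simp: L2_def)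
  also have "\<dots> = 0"
    using zero by (intro integral_eq_zero_AE) auto
  finally show ?thesis by (simp add: mult.commute)
qed

end

section \<open>Inversion and prediction\<close>

locale tv_arma = prob_space M for M :: "'a measure" +
  fixes p q :: nat and \<phi>0 :: "int \<Rightarrow> real" and \<phi> \<theta> :: "nat \<Rightarrow> int \<Rightarrow> real"
    and \<sigma> :: "int \<Rightarrow> real" and \<epsilon> y :: "int \<Rightarrow> 'a \<Rightarrow> real"
  assumes errors: "tv_arma_errors M y \<epsilon> \<sigma>"
    and bdd0: "bounded (range \<phi>0)"
    and bdd_theta: "\<forall>l\<in>{1..q}. bounded (range (\<theta> l))"
    and summ_vtheta: "\<forall>t. (\<lambda>r. \<bar>vtheta q \<theta> t r\<bar>) summable_on {..t}"
    and solution: "tv_arma_solution M p q \<phi>0 \<phi> \<theta> \<epsilon> y"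
begin

sublocale L2_process M y
  using solution by unfold_locales (simp add: tv_arma_solution_def)

lemma y_eq: "AE \<omega> in M. y t \<omega> = \<phi>0 t + (\<Sum>m=1..p. \<phi> m t * y (t - int m) \<omega>)
                           + \<epsilon> t \<omega> + (\<Sum>l=1..q. \<theta> l t * \<epsilon> (t - int l) \<omega>)"
  using solution by (simp add: tv_arma_solution_def)

lemma eps_L2: "\<epsilon> t \<in> L2 M"
  and eps_mean: "(\<integral>\<omega>. \<epsilon> t \<omega> \<partial>M) = 0"
  and eps_uncorrelated: "s \<noteq> t \<Longrightarrow> (\<integral>\<omega>. \<epsilon> t \<omega> * \<epsilon> s \<omega> \<partial>M) = 0"
  and eps_cond_exp: "AE \<omega> in M. real_cond_exp M (past_algebra M y (t - 1)) (\<epsilon> t) \<omega> = 0"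
  and eps_variance: "(\<integral>\<omega>. (\<epsilon> t \<omega>)\<^sup>2 \<partial>M) = (\<sigma> t)\<^sup>2"
  and eps_variance_bounded: "\<exists>K. \<forall>t. (\<sigma> t)\<^sup>2 \<le> K"
  using errors by (auto simp: tv_arma_errors_def)

lemma eps_orthogonal_past_algebra:
  assumes "s < t" "Z \<in> L2 M" "Z \<in> borel_measurable (past_algebra M y s)"
  shows "(\<integral>\<omega>. \<epsilon> t \<omega> * Z \<omega> \<partial>M) = 0"
proof (rule cond_exp_zero_orthogonal[OF eps_L2 assms(2) _ eps_cond_exp])
  show "Z \<in> borel_measurable (past_algebra M y (t - 1))"
    by (rule measurable_from_subalg[OF subalgebra_past_algebra_mono[of s]]) (use assms in auto)
qed

text \<open>Orthogonality to one error defines a closed subspace. It contains the constants because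
  the error has mean zero, and each \<open>y j\<close> with \<open>j \<le> s\<close> because the
  conditional mean vanishes; minimality does the rest.\<close>

lemma eps_orthogonal_past_space:
  assumes "s < t" "Z \<in> past_space M y s"
  shows "(\<integral>\<omega>. \<epsilon> t \<omega> * Z \<omega> \<partial>M) = 0"
proof -
  have "past_space M y s \<subseteq> {Z \<in> L2 M. (\<integral>\<omega>. \<epsilon> t \<omega> * Z \<omega> \<partial>M) = 0}"
    using assms(1) y_L2 eps_mean
    by (intro past_space_least closed_L2_subspace_orthogonal eps_L2)
       (auto intro!: eps_orthogonal_past_algebra[of s] L2_const measurable_past_algebra)
  then show ?thesis using assms(2) by auto
qed

section \<open>Recovering the errors from the observations\<close>

lemma vtheta_tendsto_0: "(vtheta q \<theta> r \<longlongrightarrow> 0) at_bot"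
  using summable_on_int_atMost_tendsto_0[OF summ_vtheta[rule_format, of r]]
  by (simp add: tendsto_rabs_zero_iff)

lemma vtheta_intercept_tendsto:
  "((\<lambda>n. \<Sum>j\<in>{n..r}. vtheta q \<theta> r j * \<phi>0 j) \<longlongrightarrow> (\<Sum>\<^sub>\<infinity>j\<in>{..r}. vtheta q \<theta> r j * \<phi>0 j)) at_bot"
proof (rule summable_on_int_atMost_tendsto)
  obtain K where K: "\<And>j. \<bar>\<phi>0 j\<bar> \<le> K"
    using bdd0 by (auto simp: bounded_iff)
  have "(\<lambda>j. norm (vtheta q \<theta> r j * \<phi>0 j)) summable_on {..r}"
  proof (rule Infinite_Sum.abs_summable_on_comparison_test')
    show "(\<lambda>j. \<bar>vtheta q \<theta> r j\<bar> * K) summable_on {..r}"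
      using summ_vtheta by (intro summable_on_cmult_left) auto
    show "norm (vtheta q \<theta> r j * \<phi>0 j) \<le> \<bar>vtheta q \<theta> r j\<bar> * K" for j
      using K by (simp add: abs_mult mult_left_mono)
  qed
  then show "(\<lambda>j. vtheta q \<theta> r j * \<phi>0 j) summable_on {..r}"
    by (rule Infinite_Sum.abs_summable_summable)
qed

text \<open>After summation by parts the coefficient of each error is the left side of
  \<open>vtheta_rec\<close>, a Kronecker delta, so only the error at \<open>r\<close> and the
  boundary term survive.\<close>

lemma vtheta_moving_average:
  assumes "n \<le> r"
  shows "(\<Sum>j\<in>{n..r}. vtheta q \<theta> r j * (\<epsilon> j \<omega> + (\<Sum>l=1..q. \<theta> l j * \<epsilon> (j - int l) \<omega>)))
    = \<epsilon> r \<omega> + boundary_term q \<theta> (vtheta q \<theta>) \<epsilon> r (n - 1) \<omega>"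
proof -
  have "(\<Sum>j\<in>{n..r}. vtheta q \<theta> r j * (\<epsilon> j \<omega> + (\<Sum>l=1..q. \<theta> l j * \<epsilon> (j - int l) \<omega>)))
      = (\<Sum>j\<in>{n..r}. (vtheta q \<theta> r j + (\<Sum>l=1..q. vtheta q \<theta> r (j + int l) * \<theta> l (j + int l))) * \<epsilon> j \<omega>)
        + boundary_term q \<theta> (vtheta q \<theta>) \<epsilon> r (n - 1) \<omega>"
    using sum_shift_boundary_term[where g = "vtheta q \<theta>" and r = r and n = n and q = q and c = \<theta> and x = \<epsilon> and \<omega> = \<omega>] assms
    by (simp add: distrib_left distrib_right sum.distrib vtheta_def hessenbergian_eq_0)
  also have "(\<Sum>j\<in>{n..r}. (vtheta q \<theta> r j + (\<Sum>l=1..q. vtheta q \<theta> r (j + int l) * \<theta> l (j + int l))) * \<epsilon> j \<omega>)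
      = (\<Sum>j\<in>{n..r}. if j = r then \<epsilon> r \<omega> else 0)"
    by (intro sum.cong refl) (subst vtheta_rec, auto)
  also have "\<dots> = \<epsilon> r \<omega>" using assms by simp
  finally show ?thesis .
qed

text \<open>By the model equation the bracket equals intercept plus moving average. The boundary
  term vanishes because the kernel tends to zero and the error variances are bounded. The
  autoregressive part stays inside the bracket, so no bound on the mean squares of \<open>y\<close>
  enters.\<close>

lemma innovation_has_L2_sum:
  "has_L2_sum M (\<lambda>j \<omega>. vtheta q \<theta> r j * (y j \<omega> - (\<Sum>m=1..p. \<phi> m j * y (j - int m) \<omega>))) r
    (\<lambda>\<omega>. \<epsilon> r \<omega> + (\<Sum>\<^sub>\<infinity>j\<in>{..r}. vtheta q \<theta> r j * \<phi>0 j))"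
  unfolding has_L2_sum_def
proof (rule tendsto_L2_cong_AE)
  obtain K where K: "\<And>t. (\<sigma> t)\<^sup>2 \<le> K" using eps_variance_bounded by auto
  have "tendsto_L2 M (\<lambda>u. boundary_term q \<theta> (vtheta q \<theta>) \<epsilon> r u) (\<lambda>\<omega>. 0) at_bot"
    using bdd_theta vtheta_tendsto_0
    by (rule tendsto_L2_boundary_term) (use K eps_L2 eps_variance in auto)
  from tendsto_L2_compose[OF this filterlim_int_add_at_bot[of "-1"]]
  have "tendsto_L2 M (\<lambda>n. boundary_term q \<theta> (vtheta q \<theta>) \<epsilon> r (n - 1)) (\<lambda>\<omega>. 0) at_bot"
    by simp
  from tendsto_L2_add[OF tendsto_L2_add[OF tendsto_L2_const[OF eps_L2] this]
    tendsto_L2_real[OF vtheta_intercept_tendsto]]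
  show "tendsto_L2 M (\<lambda>n \<omega>. (\<epsilon> r \<omega> + boundary_term q \<theta> (vtheta q \<theta>) \<epsilon> r (n - 1) \<omega>)
      + (\<Sum>j\<in>{n..r}. vtheta q \<theta> r j * \<phi>0 j))
      (\<lambda>\<omega>. \<epsilon> r \<omega> + 0 + (\<Sum>\<^sub>\<infinity>j\<in>{..r}. vtheta q \<theta> r j * \<phi>0 j)) at_bot" .
  show "\<forall>\<^sub>F n in at_bot.
      (\<lambda>\<omega>. \<Sum>j\<in>{n..r}. vtheta q \<theta> r j * (y j \<omega> - (\<Sum>m=1..p. \<phi> m j * y (j - int m) \<omega>))) \<in> L2 M \<and>
      (AE \<omega> in M. (\<Sum>j\<in>{n..r}. vtheta q \<theta> r j * (y j \<omega> - (\<Sum>m=1..p. \<phi> m j * y (j - int m) \<omega>)))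
        = (\<epsilon> r \<omega> + boundary_term q \<theta> (vtheta q \<theta>) \<epsilon> r (n - 1) \<omega>)
          + (\<Sum>j\<in>{n..r}. vtheta q \<theta> r j * \<phi>0 j))"
    using eventually_le_at_bot[of r]
  proof eventually_elim
    case (elim n)
    \<comment> \<open>The model holds almost everywhere at each time; countability of the integers
      yields one null set for all times.\<close>
    have "AE \<omega> in M. \<forall>j. y j \<omega> = \<phi>0 j + (\<Sum>m=1..p. \<phi> m j * y (j - int m) \<omega>)
        + \<epsilon> j \<omega> + (\<Sum>l=1..q. \<theta> l j * \<epsilon> (j - int l) \<omega>)"
      using y_eq by (simp add: AE_all_countable)
    then have "AE \<omega> in M. (\<Sum>j\<in>{n..r}. vtheta q \<theta> r j * (y j \<omega> - (\<Sum>m=1..p. \<phi> m j * y (j - int m) \<omega>)))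
        = (\<epsilon> r \<omega> + boundary_term q \<theta> (vtheta q \<theta>) \<epsilon> r (n - 1) \<omega>)
          + (\<Sum>j\<in>{n..r}. vtheta q \<theta> r j * \<phi>0 j)"
    proof (rule AE_mp, intro AE_I2 impI)
      fix \<omega>
      assume eq: "\<forall>j. y j \<omega> = \<phi>0 j + (\<Sum>m=1..p. \<phi> m j * y (j - int m) \<omega>)
        + \<epsilon> j \<omega> + (\<Sum>l=1..q. \<theta> l j * \<epsilon> (j - int l) \<omega>)"
      have "(\<Sum>j\<in>{n..r}. vtheta q \<theta> r j * (y j \<omega> - (\<Sum>m=1..p. \<phi> m j * y (j - int m) \<omega>)))
          = (\<Sum>j\<in>{n..r}. vtheta q \<theta> r j * (\<epsilon> j \<omega> + (\<Sum>l=1..q. \<theta> l j * \<epsilon> (j - int l) \<omega>))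
              + vtheta q \<theta> r j * \<phi>0 j)"
        by (intro sum.cong refl) (subst eq[rule_format], simp add: algebra_simps)
      then show "(\<Sum>j\<in>{n..r}. vtheta q \<theta> r j * (y j \<omega> - (\<Sum>m=1..p. \<phi> m j * y (j - int m) \<omega>)))
        = (\<epsilon> r \<omega> + boundary_term q \<theta> (vtheta q \<theta>) \<epsilon> r (n - 1) \<omega>)
          + (\<Sum>j\<in>{n..r}. vtheta q \<theta> r j * \<phi>0 j)"
        unfolding sum.distrib vtheta_moving_average[OF elim] .
    qed
    then show ?case
      by (auto intro!: L2_sum L2_cmult L2_diff y_L2)
  qed
qed (auto intro!: L2_add L2_const eps_L2)

text \<open>The truncated inversion sums involve only observations up to \<open>r\<close>, so
  closedness captures their limit, and subtracting a constant leaves the error.\<close>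

lemma eps_in_past_space:
  assumes "r \<le> s"
  shows "\<epsilon> r \<in> past_space M y s"
proof -
  note closed = closed_past_space[of r]
  let ?c = "\<Sum>\<^sub>\<infinity>j\<in>{..r}. vtheta q \<theta> r j * \<phi>0 j"
  have "(\<lambda>\<omega>. \<epsilon> r \<omega> + ?c) \<in> past_space M y r"
  proof (rule closed_L2_subspace_at_bot[OF closed _ innovation_has_L2_sum[unfolded has_L2_sum_def]])
    fix n
    show "(\<lambda>\<omega>. \<Sum>j\<in>{n..r}. vtheta q \<theta> r j * (y j \<omega> - (\<Sum>m=1..p. \<phi> m j * y (j - int m) \<omega>)))
        \<in> past_space M y r"
      by (intro closed_L2_subspace_sum[OF closed] closed_L2_subspaceD(4)[OF closed]
          closed_L2_subspace_diff[OF closed] y_in_past_space) auto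
  qed
  from closed_L2_subspace_diff[OF closed this const_in_past_space[of ?c]]
  have "\<epsilon> r \<in> past_space M y r" by simp
  then show ?thesis using past_space_mono[OF assms] by blast
qed

text \<open>Summation by parts with \<phi> in place of \<theta>: opening the bracket and collecting
  equal observations costs exactly this boundary term.\<close>

lemma autoregressive_expansion:
  assumes "n \<le> r + 1"
  shows "(\<Sum>j\<in>{n..r}. vtheta_p p q \<phi> \<theta> r j * y j \<omega>)
    = (\<Sum>j\<in>{n..r}. vtheta q \<theta> r j * (y j \<omega> - (\<Sum>m=1..p. \<phi> m j * y (j - int m) \<omega>)))
      + boundary_term p \<phi> (vtheta q \<theta>) y r (n - 1) \<omega>"
  using sum_shift_boundary_term[where g = "vtheta q \<theta>" and r = r and n = n and q = p and c = \<phi> and x = y and \<omega> = \<omega>] assms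
  by (simp add: vtheta_p_def left_diff_distrib right_diff_distrib sum_subtractf
    vtheta_def hessenbergian_eq_0)

text \<open>The bracketed series converges to the stated limit, so the regrouped one does so
  precisely when their difference, the boundary term, vanishes.\<close>

lemma autoregressive_has_L2_sum_iff:
  "has_L2_sum M (\<lambda>j \<omega>. vtheta_p p q \<phi> \<theta> r j * y j \<omega>) r
     (\<lambda>\<omega>. \<epsilon> r \<omega> + (\<Sum>\<^sub>\<infinity>j\<in>{..r}. vtheta q \<theta> r j * \<phi>0 j))
   \<longleftrightarrow> tendsto_L2 M (\<lambda>u. boundary_term p \<phi> (vtheta q \<theta>) y r u) (\<lambda>\<omega>. 0) at_bot"
  (is "has_L2_sum M ?V r ?Z \<longleftrightarrow> tendsto_L2 M ?b _ _")
proof -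
  let ?U = "\<lambda>n \<omega>. \<Sum>j\<in>{n..r}. vtheta q \<theta> r j * (y j \<omega> - (\<Sum>m=1..p. \<phi> m j * y (j - int m) \<omega>))"
  have U: "tendsto_L2 M ?U ?Z at_bot"
    using innovation_has_L2_sum by (simp add: has_L2_sum_def)
  have eq: "\<forall>\<^sub>F n in at_bot. (\<lambda>\<omega>. \<Sum>j\<in>{n..r}. ?V j \<omega>) = (\<lambda>\<omega>. ?U n \<omega> + ?b (n - 1) \<omega>)"
    using eventually_le_at_bot[of "r + 1"]
    by eventually_elim (auto simp: fun_eq_iff autoregressive_expansion)
  have "has_L2_sum M ?V r ?Z \<longleftrightarrow> tendsto_L2 M (\<lambda>n \<omega>. ?U n \<omega> + ?b (n - 1) \<omega>) ?Z at_bot"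
    unfolding has_L2_sum_def by (rule tendsto_L2_cong[OF eq])
  also have "\<dots> \<longleftrightarrow> tendsto_L2 M (\<lambda>n. ?b (n - 1)) (\<lambda>\<omega>. 0) at_bot"
    using tendsto_L2_diff[OF _ U, of "\<lambda>n \<omega>. ?U n \<omega> + ?b (n - 1) \<omega>" ?Z]
      tendsto_L2_add[OF U, of "\<lambda>n. ?b (n - 1)" "\<lambda>\<omega>. 0"] by auto
  also have "\<dots> \<longleftrightarrow> tendsto_L2 M ?b (\<lambda>\<omega>. 0) at_bot"
    using tendsto_L2_compose[OF _ filterlim_int_add_at_bot[of "-1"], of M ?b]
      tendsto_L2_compose[OF _ filterlim_int_add_at_bot[of 1], of M "\<lambda>n. ?b (n - 1)"] by auto
  finally show ?thesis .
qed

section \<open>Predictor and forecast error for a fixed pair \<open>s < t\<close>\<close>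

context
  fixes s t :: int
  assumes repr: "has_L2_sum M (\<lambda>r \<omega>. xi_q p q \<phi> \<theta> t r * \<epsilon> r \<omega>) t
                     (\<lambda>\<omega>. y t \<omega> - (\<Sum>\<^sub>\<infinity>r\<in>{..t}. xi p \<phi> t r * \<phi>0 r))"
    and st: "s < t"
begin

definition forecast_error :: "'a \<Rightarrow> real" where
  "forecast_error \<omega> = (\<Sum>r\<in>{s+1..t}. xi_q p q \<phi> \<theta> t r * \<epsilon> r \<omega>)"

lemma forecast_error_L2: "forecast_error \<in> L2 M"
  unfolding forecast_error_def[abs_def] by (intro L2_sum L2_cmult eps_L2)

text \<open>Stated through orthogonality to the single later errors, so that it applies alike to
  elements of the past space, to constants, and to the difference of a projection and a
  past-measurable competitor.\<close>

lemma forecast_error_orthogonal: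
  assumes "Z \<in> L2 M" "\<And>r. s < r \<Longrightarrow> (\<integral>\<omega>. \<epsilon> r \<omega> * Z \<omega> \<partial>M) = 0"
  shows "(\<integral>\<omega>. forecast_error \<omega> * Z \<omega> \<partial>M) = 0"
proof -
  have "(\<integral>\<omega>. forecast_error \<omega> * Z \<omega> \<partial>M)
      = (\<Sum>r\<in>{s+1..t}. \<integral>\<omega>. xi_q p q \<phi> \<theta> t r * (\<epsilon> r \<omega> * Z \<omega>) \<partial>M)"
    unfolding forecast_error_def sum_distrib_right mult.assoc
    by (intro Bochner_Integration.integral_sum integrable_mult_right L2_integrable_mult eps_L2 assms)
  also have "\<dots> = 0" using assms(2) by simp
  finally show ?thesis .
qed

text \<open>Removing the finitely many summands after \<open>s\<close> from the representation of
  \<open>y t\<close> leaves the series up to \<open>s\<close>. Writing the predictor as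
  \<open>y t\<close> minus the forecast error supplies its limit without a separate convergence
  proof.\<close>

lemma predictor_has_L2_sum:
  "has_L2_sum M (\<lambda>r \<omega>. xi_q p q \<phi> \<theta> t r * \<epsilon> r \<omega>) s
    (\<lambda>\<omega>. y t \<omega> - forecast_error \<omega> - (\<Sum>\<^sub>\<infinity>r\<in>{..t}. xi p \<phi> t r * \<phi>0 r))"
proof -
  let ?X = "\<lambda>r \<omega>. xi_q p q \<phi> \<theta> t r * \<epsilon> r \<omega>"
  have "\<forall>\<^sub>F n in at_bot. (\<lambda>\<omega>. (\<Sum>r\<in>{n..t}. ?X r \<omega>) - forecast_error \<omega>) = (\<lambda>\<omega>. \<Sum>r\<in>{n..s}. ?X r \<omega>)"
    using eventually_le_at_bot[of "s + 1"]
  proof eventually_elim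
    case (elim n)
    have "{n..t} = {n..s} \<union> {s+1..t}" using elim st by auto
    then have "(\<Sum>r\<in>{n..t}. ?X r \<omega>) = (\<Sum>r\<in>{n..s}. ?X r \<omega>) + forecast_error \<omega>" for \<omega>
      unfolding forecast_error_def by (simp add: sum.union_disjoint)
    then show ?case by simp
  qed
  from tendsto_L2_cong[OF this] have "tendsto_L2 M (\<lambda>n \<omega>. \<Sum>r\<in>{n..s}. ?X r \<omega>)
      (\<lambda>\<omega>. y t \<omega> - (\<Sum>\<^sub>\<infinity>r\<in>{..t}. xi p \<phi> t r * \<phi>0 r) - forecast_error \<omega>) at_bot"
    using tendsto_L2_diff[OF repr[unfolded has_L2_sum_def] tendsto_L2_const[OF forecast_error_L2]]
    by blast
  then show ?thesis
    by (simp add: has_L2_sum_def algebra_simps)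
qed

text \<open>Membership: the errors up to \<open>s\<close> lie in the past space, which is closed and
  contains the constants. Orthogonality: the residual is a combination of errors after
  \<open>s\<close>.\<close>

lemma is_L2_projection_predictor:
  "is_L2_projection M (past_space M y s) (y t) (\<lambda>\<omega>. y t \<omega> - forecast_error \<omega>)"
  unfolding is_L2_projection_def
proof
  note closed = closed_past_space[of s]
  let ?c = "\<Sum>\<^sub>\<infinity>r\<in>{..t}. xi p \<phi> t r * \<phi>0 r"
  have "(\<lambda>\<omega>. y t \<omega> - forecast_error \<omega> - ?c) \<in> past_space M y s"
  proof (rule closed_L2_subspace_at_bot[OF closed _ predictor_has_L2_sum[unfolded has_L2_sum_def]])
    show "(\<lambda>\<omega>. \<Sum>r\<in>{n..s}. xi_q p q \<phi> \<theta> t r * \<epsilon> r \<omega>) \<in> past_space M y s" for n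
      by (intro closed_L2_subspace_sum[OF closed] closed_L2_subspaceD(4)[OF closed] eps_in_past_space) auto
  qed
  from closed_L2_subspaceD(3)[OF closed this const_in_past_space[of ?c]]
  show "(\<lambda>\<omega>. y t \<omega> - forecast_error \<omega>) \<in> past_space M y s" by simp
  show "\<forall>Z\<in>past_space M y s. (\<integral>\<omega>. (y t \<omega> - (y t \<omega> - forecast_error \<omega>)) * Z \<omega> \<partial>M) = 0"
    using closed_L2_subspaceD(1)[OF closed]
    by (auto intro!: forecast_error_orthogonal eps_orthogonal_past_space)
qed

text \<open>Projections are unique up to null sets: the difference \<open>?D\<close> of two of them
  lies in the past space, is orthogonal to both residuals and hence to itself.\<close>

lemma is_L2_projection_AE:
  assumes P: "is_L2_projection M (past_space M y s) (y t) P"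
  shows "P \<in> past_space M y s" "P \<in> L2 M" "AE \<omega> in M. y t \<omega> - P \<omega> = forecast_error \<omega>"
proof -
  note closed = closed_past_space[of s]
  let ?Q = "\<lambda>\<omega>. y t \<omega> - forecast_error \<omega>"
  let ?D = "\<lambda>\<omega>. P \<omega> - ?Q \<omega>"
  show P_in: "P \<in> past_space M y s" and P_L2: "P \<in> L2 M"
    using P closed_L2_subspaceD(1)[OF closed] by (auto simp: is_L2_projection_def)
  have D: "?D \<in> past_space M y s"
    using is_L2_projection_predictor P_in closed_L2_subspace_diff[OF closed]
    by (auto simp: is_L2_projection_def)
  then have D_L2: "?D \<in> L2 M" using closed_L2_subspaceD(1)[OF closed] by blast
  have zero: "(\<integral>\<omega>. (y t \<omega> - ?Q \<omega>) * ?D \<omega> \<partial>M) = 0" "(\<integral>\<omega>. (y t \<omega> - P \<omega>) * ?D \<omega> \<partial>M) = 0"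
    using P is_L2_projection_predictor D by (auto simp: is_L2_projection_def)
  \<comment> \<open>\<open>?D\<close> is also the difference of the two residuals.\<close>
  have "(\<integral>\<omega>. (?D \<omega>)\<^sup>2 \<partial>M) = (\<integral>\<omega>. (y t \<omega> - ?Q \<omega>) * ?D \<omega> - (y t \<omega> - P \<omega>) * ?D \<omega> \<partial>M)"
    by (intro Bochner_Integration.integral_cong refl) (simp add: power2_eq_square algebra_simps)
  also have "\<dots> = (\<integral>\<omega>. (y t \<omega> - ?Q \<omega>) * ?D \<omega> \<partial>M) - (\<integral>\<omega>. (y t \<omega> - P \<omega>) * ?D \<omega> \<partial>M)"
    by (intro Bochner_Integration.integral_diff L2_integrable_mult L2_diff y_L2 P_L2 forecast_error_L2)
  finally have "(\<integral>\<omega>. (?D \<omega>)\<^sup>2 \<partial>M) = 0" using zero by simp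
  then have "AE \<omega> in M. (?D \<omega>)\<^sup>2 = 0"
    using L2D(2)[OF D_L2] by (simp add: integral_nonneg_eq_0_iff_AE)
  then show "AE \<omega> in M. y t \<omega> - P \<omega> = forecast_error \<omega>" by auto
qed

lemma forecast_error_mean: "expectation forecast_error = 0"
  using forecast_error_orthogonal[OF L2_const[of 1]] eps_mean by simp

lemma forecast_error_variance:
  "variance forecast_error = (\<Sum>r\<in>{s+1..t}. (xi_q p q \<phi> \<theta> t r)\<^sup>2 * (\<sigma> r)\<^sup>2)"
proof -
  have "variance forecast_error = (\<integral>\<omega>. (\<Sum>r\<in>{s+1..t}. xi_q p q \<phi> \<theta> t r * \<epsilon> r \<omega>)\<^sup>2 \<partial>M)"
    unfolding forecast_error_mean by (simp add: forecast_error_def)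
  also have "\<dots> = (\<Sum>r\<in>{s+1..t}. (xi_q p q \<phi> \<theta> t r)\<^sup>2 * (\<integral>\<omega>. (\<epsilon> r \<omega>)\<^sup>2 \<partial>M))"
    by (rule integral_square_sum_orthogonal) (auto intro: eps_L2 eps_uncorrelated)
  finally show ?thesis by (simp add: eps_variance)
qed

text \<open>The competitors are all square-integrable functions measurable with respect to the past,
  nonlinear ones included. The conditional-mean condition makes every later error orthogonal to them
  too, so the residual is orthogonal to \<open>P - Z\<close> and Pythagoras applies.\<close>

lemma projection_optimal:
  assumes P: "is_L2_projection M (past_space M y s) (y t) P"
    and Z: "Z \<in> L2 M" "Z \<in> borel_measurable (past_algebra M y s)"
  shows "(\<integral>\<omega>. (y t \<omega> - P \<omega>)\<^sup>2 \<partial>M) \<le> (\<integral>\<omega>. (y t \<omega> - Z \<omega>)\<^sup>2 \<partial>M)"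
proof -
  note P' = is_L2_projection_AE[OF P]
  note E_L2 = L2_diff[OF y_L2 P'(2)] and D_L2 = L2_diff[OF P'(2) Z(1)]
  have meas: "y t \<in> borel_measurable M" "P \<in> borel_measurable M" "Z \<in> borel_measurable M"
    "forecast_error \<in> borel_measurable M"
    using y_L2 P' Z(1) forecast_error_L2 by (auto simp: L2_def)
  have "(\<integral>\<omega>. (y t \<omega> - P \<omega>) * (P \<omega> - Z \<omega>) \<partial>M) = (\<integral>\<omega>. forecast_error \<omega> * (P \<omega> - Z \<omega>) \<partial>M)"
    using P'(3) meas by (intro integral_cong_AE) (measurable, auto)
  also have "\<dots> = 0"
  proof (rule forecast_error_orthogonal[OF D_L2])
    \<comment> \<open>\<open>P\<close> is treated through the past space and \<open>Z\<close>
      through the past algebra, as \<open>P\<close> may differ from a past-measurable function on a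
      null set.\<close>
    fix r assume "s < r"
    then show "(\<integral>\<omega>. \<epsilon> r \<omega> * (P \<omega> - Z \<omega>) \<partial>M) = 0"
      using L2_integrable_mult[OF eps_L2 P'(2), of r] L2_integrable_mult[OF eps_L2 Z(1), of r]
        eps_orthogonal_past_space[OF _ P'(1)] eps_orthogonal_past_algebra[OF _ Z]
      by (simp add: right_diff_distrib)
  qed
  finally have orth: "(\<integral>\<omega>. (y t \<omega> - P \<omega>) * (P \<omega> - Z \<omega>) \<partial>M) = 0" .
  have "(\<integral>\<omega>. (y t \<omega> - Z \<omega>)\<^sup>2 \<partial>M)
      = (\<integral>\<omega>. (y t \<omega> - P \<omega>)\<^sup>2 + 2 * ((y t \<omega> - P \<omega>) * (P \<omega> - Z \<omega>)) + (P \<omega> - Z \<omega>)\<^sup>2 \<partial>M)"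
    by (intro Bochner_Integration.integral_cong refl) (simp add: power2_eq_square algebra_simps)
  also have "\<dots> = (\<integral>\<omega>. (y t \<omega> - P \<omega>)\<^sup>2 \<partial>M) + (\<integral>\<omega>. (P \<omega> - Z \<omega>)\<^sup>2 \<partial>M)"
    using L2D(2)[OF E_L2] L2D(2)[OF D_L2] L2_integrable_mult[OF E_L2 D_L2] by (simp add: orth)
  finally show ?thesis by simp
qed

lemma projection_has_L2_sum:
  assumes P: "is_L2_projection M (past_space M y s) (y t) P"
  shows "has_L2_sum M (\<lambda>r \<omega>. xi_q p q \<phi> \<theta> t r * \<epsilon> r \<omega>) s
    (\<lambda>\<omega>. P \<omega> - (\<Sum>\<^sub>\<infinity>r\<in>{..t}. xi p \<phi> t r * \<phi>0 r))"
  using predictor_has_L2_sum unfolding has_L2_sum_def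
proof (rule tendsto_L2_cong_AE)
  show "AE \<omega> in M. P \<omega> - (\<Sum>\<^sub>\<infinity>r\<in>{..t}. xi p \<phi> t r * \<phi>0 r)
      = y t \<omega> - forecast_error \<omega> - (\<Sum>\<^sub>\<infinity>r\<in>{..t}. xi p \<phi> t r * \<phi>0 r)"
    using is_L2_projection_AE(3)[OF P] by eventually_elim simp
qed (auto intro!: always_eventually L2_sum L2_cmult eps_L2 L2_diff L2_const is_L2_projection_AE(2)[OF P])

lemma projection_error_moments:
  assumes P: "is_L2_projection M (past_space M y s) (y t) P"
  shows "expectation (\<lambda>\<omega>. y t \<omega> - P \<omega>) = 0"
    "variance (\<lambda>\<omega>. y t \<omega> - P \<omega>) = (\<Sum>r\<in>{s+1..t}. (xi_q p q \<phi> \<theta> t r)\<^sup>2 * (\<sigma> r)\<^sup>2)"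
proof -
  note AE = is_L2_projection_AE(3)[OF P]
  have meas [measurable]: "y t \<in> borel_measurable M" "P \<in> borel_measurable M"
    "forecast_error \<in> borel_measurable M"
    using y_L2 is_L2_projection_AE(2)[OF P] forecast_error_L2 by (auto simp: L2_def)
  have mean: "expectation (\<lambda>\<omega>. y t \<omega> - P \<omega>) = expectation forecast_error"
    by (rule integral_cong_AE) (use AE in auto)
  then show "expectation (\<lambda>\<omega>. y t \<omega> - P \<omega>) = 0" by (simp add: forecast_error_mean)
  have "variance (\<lambda>\<omega>. y t \<omega> - P \<omega>) = variance forecast_error"
    unfolding mean by (rule integral_cong_AE) (use AE in auto)
  then show "variance (\<lambda>\<omega>. y t \<omega> - P \<omega>) = (\<Sum>r\<in>{s+1..t}. (xi_q p q \<phi> \<theta> t r)\<^sup>2 * (\<sigma> r)\<^sup>2)"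
    by (simp only: forecast_error_variance)
qed

end

end

text \<open>Projections are unique only up to null sets, so existence is asserted and the formulas
  are given for every version \<open>P\<close>. The inversion appears in bracketed form, and
  regrouped by single observations exactly when the boundary term vanishes, in particular when the
  mean squares of \<open>y\<close> up to \<open>s\<close> are bounded.\<close>

theorem proposition5:
  fixes M :: "'a measure"
    and p q :: nat
    and \<phi>0 :: "int \<Rightarrow> real"
    and \<phi> \<theta> :: "nat \<Rightarrow> int \<Rightarrow> real"
    and \<sigma> :: "int \<Rightarrow> real"
    and \<epsilon> y :: "int \<Rightarrow> 'a \<Rightarrow> real"
    and s t :: int
  assumes prob: "prob_space M"
    and p: "1 \<le> p" and q: "1 \<le> q"
    and errors: "tv_arma_errors M y \<epsilon> \<sigma>"
    and bdd0: "bounded (range \<phi>0)"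
    and bdd_phi: "\<forall>m\<in>{1..p}. bounded (range (\<phi> m))"
    and bdd_theta: "\<forall>l\<in>{1..q}. bounded (range (\<theta> l))"
    and summ_xi: "\<forall>t. (\<lambda>r. \<bar>xi p \<phi> t r\<bar>) summable_on {..t}"
    and summ_vtheta: "\<forall>t. (\<lambda>r. \<bar>vtheta q \<theta> t r\<bar>) summable_on {..t}"
    and solution: "tv_arma_solution M p q \<phi>0 \<phi> \<theta> \<epsilon> y"
    and stable: "asymptotically_stable M p \<phi> y"
    and repr: "\<forall>t. has_L2_sum M (\<lambda>r \<omega>. xi_q p q \<phi> \<theta> t r * \<epsilon> r \<omega>) t
                     (\<lambda>\<omega>. y t \<omega> - (\<Sum>\<^sub>\<infinity>r\<in>{..t}. xi p \<phi> t r * \<phi>0 r))"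
    and st: "s < t"
  shows
    "(\<exists>P. is_L2_projection M (past_space M y s) (y t) P) \<and>
     (\<forall>P. is_L2_projection M (past_space M y s) (y t) P \<longrightarrow>
        (\<forall>Z\<in>L2 M \<inter> borel_measurable (past_algebra M y s).
           (\<integral>\<omega>. (y t \<omega> - P \<omega>)\<^sup>2 \<partial>M) \<le> (\<integral>\<omega>. (y t \<omega> - Z \<omega>)\<^sup>2 \<partial>M)) \<and>
        has_L2_sum M (\<lambda>r \<omega>. xi_q p q \<phi> \<theta> t r * \<epsilon> r \<omega>) s
          (\<lambda>\<omega>. P \<omega> - (\<Sum>\<^sub>\<infinity>r\<in>{..t}. xi p \<phi> t r * \<phi>0 r)) \<and>
        (AE \<omega> in M. y t \<omega> - P \<omega> = (\<Sum>r\<in>{s+1..t}. xi_q p q \<phi> \<theta> t r * \<epsilon> r \<omega>)) \<and>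
        prob_space.variance M (\<lambda>\<omega>. y t \<omega> - P \<omega>)
          = (\<Sum>r\<in>{s+1..t}. (xi_q p q \<phi> \<theta> t r)\<^sup>2 * (\<sigma> r)\<^sup>2) \<and>
        prob_space.expectation M (\<lambda>\<omega>. y t \<omega> - P \<omega>) = 0) \<and>
     (\<forall>r\<le>s.
        has_L2_sum M
          (\<lambda>j \<omega>. vtheta q \<theta> r j * (y j \<omega> - (\<Sum>m=1..p. \<phi> m j * y (j - int m) \<omega>))) r
          (\<lambda>\<omega>. \<epsilon> r \<omega> + (\<Sum>\<^sub>\<infinity>j\<in>{..r}. vtheta q \<theta> r j * \<phi>0 j)) \<and>
        (has_L2_sum M (\<lambda>j \<omega>. vtheta_p p q \<phi> \<theta> r j * y j \<omega>) r
           (\<lambda>\<omega>. \<epsilon> r \<omega> + (\<Sum>\<^sub>\<infinity>j\<in>{..r}. vtheta q \<theta> r j * \<phi>0 j))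
         \<longleftrightarrow> tendsto_L2 M (\<lambda>u. boundary_term p \<phi> (vtheta q \<theta>) y r u) (\<lambda>\<omega>. 0) at_bot) \<and>
        ((\<exists>B. \<forall>j\<le>s. (\<integral>\<omega>. (y j \<omega>)\<^sup>2 \<partial>M) \<le> B) \<longrightarrow>
           has_L2_sum M (\<lambda>j \<omega>. vtheta_p p q \<phi> \<theta> r j * y j \<omega>) r
             (\<lambda>\<omega>. \<epsilon> r \<omega> + (\<Sum>\<^sub>\<infinity>j\<in>{..r}. vtheta q \<theta> r j * \<phi>0 j))))"
proof -
  interpret tv_arma M p q \<phi>0 \<phi> \<theta> \<sigma> \<epsilon> y
    using prob errors bdd0 bdd_theta summ_vtheta solution
    by (intro tv_arma.intro tv_arma_axioms.intro)
  note repr_t = repr[rule_format, of t]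
  have "has_L2_sum M (\<lambda>j \<omega>. vtheta_p p q \<phi> \<theta> r j * y j \<omega>) r
      (\<lambda>\<omega>. \<epsilon> r \<omega> + (\<Sum>\<^sub>\<infinity>j\<in>{..r}. vtheta q \<theta> r j * \<phi>0 j))"
    if bdd: "\<exists>B. \<forall>j\<le>s. (\<integral>\<omega>. (y j \<omega>)\<^sup>2 \<partial>M) \<le> B" for r
  proof -
    obtain B where "\<And>j. j \<le> s \<Longrightarrow> (\<integral>\<omega>. (y j \<omega>)\<^sup>2 \<partial>M) \<le> B" using bdd by blast
    then show ?thesis
      unfolding autoregressive_has_L2_sum_iff
      by (intro tendsto_L2_boundary_term[OF bdd_phi vtheta_tendsto_0]) (simp add: y_L2)
  qed
  moreover have "\<exists>P. is_L2_projection M (past_space M y s) (y t) P"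
    using is_L2_projection_predictor[OF repr_t st] by blast
  moreover note projection_optimal[OF repr_t st] projection_has_L2_sum[OF repr_t st]
    is_L2_projection_AE(3)[OF repr_t st, unfolded forecast_error_def[OF repr_t st]]
    projection_error_moments[OF repr_t st] innovation_has_L2_sum autoregressive_has_L2_sum_iff
  ultimately show ?thesis by (intro conjI allI impI ballI) blast+
qed

end
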